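(* For all real $\mu',\mu''$ with $0\le\mu'<\mu''$, we have $(|B_t^{\mu'}|)_{t\ge0}\preceq_{st}(|B_t^{\mu''}|)_{t\ge0}$, where both sides are random elements of $C[0,\infty)$. That is, $(|B_t^{\mu}|)_{t\ge0}$ is stochastically increasing in $\mu\in[0,\infty)$ (and hence decreasing in $\mu\in(-\infty,0]$).
   Context: $(B_t)_{t\ge0}$ is standard Brownian motion (with continuous paths, $B_0=0$) and $B_t^\mu=B_t+\mu t$ is Brownian motion with drift parameter $\mu\in\mathbb R$. $C[0,\infty)$ is the Polish space of real continuous functions on $[0,\infty)$ with the topology of uniform convergence on compact sets and its Borel $\sigma$-field, partially ordered by $x\le^* y$ if and only if $x(t)\le y(t)$ for all $t\ge0$. For random elements $\xi,\eta$ of $C[0,\infty)$ (not necessarily on the same probability space), $\xi\preceq_{st}\eta$ means $E f(\xi)\le E f(\eta)$ for all bounded measurable $f:C[0,\infty)\to\mathbb R$ that are increasing, i.e. $f(x)\le f(y)$ whenever $x\le^* y$. "Increasing" and "decreasing" are meant in the non-strict sense. *)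

theory Defs
  imports "HOL-Probability.Probability"
begin

section \<open>The ordered topological space \<open>C[0,\<infinity>)\<close>\<close>

text \<open>Functions on \<open>[0,\<infinity>)\<close> are represented by total functions that are
  extensional on \<open>{0..}\<close>, so that equality is equality of the restrictions.\<close>

typedef cpath = "{x :: real \<Rightarrow> real. continuous_on {0..} x \<and> x \<in> extensional {0..}}"
  morphisms eval_path Path
proof -
  have "continuous_on {0..} (restrict (\<lambda>_ :: real. 0 :: real) {0..})"
    by (rule continuous_on_eq[OF continuous_on_const[of _ 0]]) simp
  then show ?thesis
    by blast
qed

instantiation cpath :: order
begin

definition less_eq_cpath :: "cpath \<Rightarrow> cpath \<Rightarrow> bool" where
  "x \<le> y \<longleftrightarrow> (\<forall>t\<ge>0. eval_path x t \<le> eval_path y t)"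

definition less_cpath :: "cpath \<Rightarrow> cpath \<Rightarrow> bool" where
  "x < y \<longleftrightarrow> x \<le> y \<and> \<not> y \<le> x" for x y :: cpath

instance
proof
  fix x y z :: cpath
  show "x < y \<longleftrightarrow> x \<le> y \<and> \<not> y \<le> x"
    by (rule less_cpath_def)
  show "x \<le> x"
    by (simp add: less_eq_cpath_def)
  show "x \<le> z" if "x \<le> y" "y \<le> z"
    using that unfolding less_eq_cpath_def by (meson order_trans)
  show "x = y" if "x \<le> y" "y \<le> x"
  proof -
    have "eval_path x \<in> extensional {0..}" "eval_path y \<in> extensional {0..}"
      using eval_path by auto
    moreover have "eval_path x t = eval_path y t" if "t \<in> {0..}" for t
      using that \<open>x \<le> y\<close> \<open>y \<le> x\<close> unfolding less_eq_cpath_def by (meson antisym atLeast_iff)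
    ultimately have "eval_path x = eval_path y"
      by (rule extensionalityI)
    then show ?thesis
      by (simp add: eval_path_inject)
  qed
qed

end

instantiation cpath :: topological_space
begin

text \<open>The topology of uniform convergence on compact sets; see
  \<open>tendsto_cpath_iff\<close> below.\<close>

definition open_cpath :: "cpath set \<Rightarrow> bool" where
  "open U \<longleftrightarrow> (\<forall>x\<in>U. \<exists>K e. compact K \<and> K \<subseteq> {0..} \<and> e > 0 \<and>
     (\<forall>y. (\<forall>t\<in>K. dist (eval_path y t) (eval_path x t) < e) \<longrightarrow> y \<in> U))"

instance
proof
  show "open (UNIV :: cpath set)"
    unfolding open_cpath_def by (auto intro!: exI[of _ "{}"] exI[of _ 1])
  fix S T :: "cpath set"
  assume S: "open S" and T: "open T"
  show "open (S \<inter> T)"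
    unfolding open_cpath_def
  proof
    fix x assume "x \<in> S \<inter> T"
    then obtain K d L e where
      "compact K" "K \<subseteq> {0..}" "d > 0"
      and K: "\<And>y. (\<forall>t\<in>K. dist (eval_path y t) (eval_path x t) < d) \<Longrightarrow> y \<in> S"
      and "compact L" "L \<subseteq> {0..}" "e > 0"
      and L: "\<And>y. (\<forall>t\<in>L. dist (eval_path y t) (eval_path x t) < e) \<Longrightarrow> y \<in> T"
      using S T unfolding open_cpath_def by (metis IntD1 IntD2)
    then have "compact (K \<union> L) \<and> K \<union> L \<subseteq> {0..} \<and> min d e > 0 \<and>
        (\<forall>y. (\<forall>t\<in>K \<union> L. dist (eval_path y t) (eval_path x t) < min d e) \<longrightarrow> y \<in> S \<inter> T)"
      by (auto simp: compact_Un)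
    then show "\<exists>K e. compact K \<and> K \<subseteq> {0..} \<and> e > 0 \<and>
        (\<forall>y. (\<forall>t\<in>K. dist (eval_path y t) (eval_path x t) < e) \<longrightarrow> y \<in> S \<inter> T)"
      by blast
  qed
next
  fix \<S> :: "cpath set set"
  assume "\<forall>S\<in>\<S>. open S"
  then show "open (\<Union>\<S>)"
    unfolding open_cpath_def by (meson UnionE UnionI)
qed

end

lemma open_cpath_nhd:
  assumes "compact K" "K \<subseteq> {0..}" "e > 0"
  shows "open {y. \<forall>t\<in>K. dist (eval_path y t) (eval_path x t) < e}"
  unfolding open_cpath_def
proof
  fix y assume "y \<in> {y. \<forall>t\<in>K. dist (eval_path y t) (eval_path x t) < e}"
  then have y: "\<forall>t\<in>K. dist (eval_path y t) (eval_path x t) < e"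
    by simp
  have "\<exists>d>0. \<forall>t\<in>K. dist (eval_path y t) (eval_path x t) \<le> e - d"
  proof (cases "K = {}")
    case False
    have "continuous_on K (eval_path z)" for z
      using eval_path[of z] \<open>K \<subseteq> {0..}\<close> by (auto intro: continuous_on_subset)
    then have "continuous_on K (\<lambda>t. dist (eval_path y t) (eval_path x t))"
      by (intro continuous_on_dist)
    then obtain s where "s \<in> K"
      and s: "\<forall>t\<in>K. dist (eval_path y t) (eval_path x t) \<le> dist (eval_path y s) (eval_path x s)"
      using continuous_attains_sup[OF \<open>compact K\<close> False] by blast
    with y show ?thesis
      by (intro exI[of _ "e - dist (eval_path y s) (eval_path x s)"]) simp
  qed (auto intro: exI[of _ 1])
  then obtain d where "d > 0" and d: "\<forall>t\<in>K. dist (eval_path y t) (eval_path x t) \<le> e - d"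
    by blast
  have "z \<in> {y. \<forall>t\<in>K. dist (eval_path y t) (eval_path x t) < e}"
    if "\<forall>t\<in>K. dist (eval_path z t) (eval_path y t) < d" for z
  proof safe
    fix t assume "t \<in> K"
    then show "dist (eval_path z t) (eval_path x t) < e"
      using that d dist_triangle[of "eval_path z t" "eval_path x t" "eval_path y t"] by fastforce
  qed
  with \<open>d > 0\<close> assms show "\<exists>L d. compact L \<and> L \<subseteq> {0..} \<and> d > 0 \<and>
      (\<forall>z. (\<forall>t\<in>L. dist (eval_path z t) (eval_path y t) < d) \<longrightarrow>
        z \<in> {y. \<forall>t\<in>K. dist (eval_path y t) (eval_path x t) < e})"
    by blast
qed

lemma tendsto_cpath_iff:
  "(f \<longlongrightarrow> x) F \<longleftrightarrow>
     (\<forall>K. compact K \<and> K \<subseteq> {0..} \<longrightarrow> uniform_limit K (\<lambda>n. eval_path (f n)) (eval_path x) F)"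
proof safe
  fix K :: "real set"
  assume f: "(f \<longlongrightarrow> x) F" and K: "compact K" "K \<subseteq> {0..}"
  show "uniform_limit K (\<lambda>n. eval_path (f n)) (eval_path x) F"
  proof (rule uniform_limitI)
    fix e :: real assume "e > 0"
    from topological_tendstoD[OF f open_cpath_nhd[OF K this, of x]] this
    show "\<forall>\<^sub>F n in F. \<forall>t\<in>K. dist (eval_path (f n) t) (eval_path x t) < e"
      by simp
  qed
next
  assume *: "\<forall>K. compact K \<and> K \<subseteq> {0..} \<longrightarrow>
    uniform_limit K (\<lambda>n. eval_path (f n)) (eval_path x) F"
  show "(f \<longlongrightarrow> x) F"
  proof (rule topological_tendstoI)
    fix U assume "open U" "x \<in> U"
    then obtain K e where K: "compact K" "K \<subseteq> {0..}" "e > 0"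
      and U: "\<And>y. (\<forall>t\<in>K. dist (eval_path y t) (eval_path x t) < e) \<Longrightarrow> y \<in> U"
      unfolding open_cpath_def by metis
    have "\<forall>\<^sub>F n in F. \<forall>t\<in>K. dist (eval_path (f n) t) (eval_path x t) < e"
      using * K by (blast dest: uniform_limitD)
    then show "\<forall>\<^sub>F n in F. f n \<in> U"
      by (rule eventually_mono) (rule U)
  qed
qed


section \<open>Stochastic order\<close>

text \<open>Meaningful for random elements \<open>\<xi> \<in> borel_measurable M\<close> and
  \<open>\<eta> \<in> borel_measurable N\<close> of \<open>C[0,\<infinity>)\<close>; otherwise the integrals may
  take the default value 0.\<close>

definition stoch_le :: "'a measure \<Rightarrow> ('a \<Rightarrow> cpath) \<Rightarrow> 'b measure \<Rightarrow> ('b \<Rightarrow> cpath) \<Rightarrow> bool" where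
  "stoch_le M \<xi> N \<eta> \<longleftrightarrow>
     (\<forall>f :: cpath \<Rightarrow> real. f \<in> borel_measurable borel \<and> bounded (range f) \<and> mono f \<longrightarrow>
        (\<integral>\<omega>. f (\<xi> \<omega>) \<partial>M) \<le> (\<integral>\<omega>. f (\<eta> \<omega>) \<partial>N))"


section \<open>Brownian motion\<close>

locale brownian_motion = prob_space M for M :: "'a measure" +
  fixes B :: "real \<Rightarrow> 'a \<Rightarrow> real"
  assumes random_variable_BM: "0 \<le> t \<Longrightarrow> random_variable borel (B t)"
    and start_BM: "\<omega> \<in> space M \<Longrightarrow> B 0 \<omega> = 0"
    and continuous_BM: "\<omega> \<in> space M \<Longrightarrow> continuous_on {0..} (\<lambda>t. B t \<omega>)"
    and increment_BM: "0 \<le> s \<Longrightarrow> s < t \<Longrightarrow>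
      distributed M lborel (\<lambda>\<omega>. B t \<omega> - B s \<omega>) (normal_density 0 (sqrt (t - s)))"
    and indep_increments_BM: "0 \<le> \<tau> 0 \<Longrightarrow> mono \<tau> \<Longrightarrow>
      indep_vars (\<lambda>_. borel) (\<lambda>i \<omega>. B (\<tau> (Suc i)) \<omega> - B (\<tau> i) \<omega>) {..<n :: nat}"

definition drift_BM :: "(real \<Rightarrow> 'a \<Rightarrow> real) \<Rightarrow> real \<Rightarrow> real \<Rightarrow> 'a \<Rightarrow> real" where
  "drift_BM B \<mu> t \<omega> = B t \<omega> + \<mu> * t"

definition abs_drift_path :: "(real \<Rightarrow> 'a \<Rightarrow> real) \<Rightarrow> real \<Rightarrow> 'a \<Rightarrow> cpath" where
  "abs_drift_path B \<mu> \<omega> = Path (restrict (\<lambda>t. \<bar>drift_BM B \<mu> t \<omega>\<bar>) {0..})"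

lemma (in brownian_motion) eval_abs_drift_path:
  assumes "\<omega> \<in> space M" "t \<ge> 0"
  shows "eval_path (abs_drift_path B \<mu> \<omega>) t = \<bar>B t \<omega> + \<mu> * t\<bar>"
proof -
  have "continuous_on {0..} (\<lambda>t. \<bar>B t \<omega> + \<mu> * t\<bar>)"
    using continuous_BM[OF assms(1)] by (intro continuous_intros)
  then have "continuous_on {0..} (restrict (\<lambda>t. \<bar>B t \<omega> + \<mu> * t\<bar>) {0..})"
    by (rule continuous_on_eq) simp
  with assms(2) show ?thesis
    unfolding abs_drift_path_def drift_BM_def by (subst Path_inverse) auto
qed

end

theory Submission
  imports Defs
begin

text \<open>Why the theorem is true. Write \<open>X = B\<^sup>\<mu>\<close>. Tilting its law by the weight \<open>exp (- \<mu> X\<^sub>t)\<close>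
  removes the drift, and driftless Brownian motion is symmetric; so, given the path of \<open>\<bar>X\<bar>\<close> up to
  time \<open>t\<close>, the sign of \<open>X\<^sub>t\<close> is \<open>+1\<close> or \<open>-1\<close> with odds \<open>exp (\<mu> \<bar>X\<^sub>t\<bar>) : exp (- \<mu> \<bar>X\<^sub>t\<bar>)\<close>
  (\<open>grid_path_reflection\<close>). Hence \<open>\<bar>X\<bar>\<close> sampled along a grid of mesh \<open>d\<close> is a Markov chain
  (\<open>abs_grid_path_step\<close>), with transition density proportional in \<open>y\<close> to
  \<open>exp (- y\<^sup>2 / 2d) cosh (x y / d) cosh (\<mu> y)\<close>.
  Since \<open>cosh (u y) / cosh (v y)\<close> increases in \<open>\<bar>y\<bar>\<close> when \<open>\<bar>v\<bar> \<le> \<bar>u\<bar>\<close>, this density has increasing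
  likelihood ratio in the starting point \<open>x\<close> as well as in \<open>\<bar>\<mu>\<bar>\<close>. Transitions therefore preserve increasing
  functions and increase with \<open>\<bar>\<mu>\<bar>\<close> (\<open>abs_kernel_mono\<close>), and induction on the number of steps gives
  the stochastic order for the finite-dimensional distributions (\<open>abs_grid_path_mono_drift\<close>). Only
  \<open>\<bar>\<mu>\<bar>\<close> enters, so the case of negative drifts needs no separate argument.

  To pass to path space, a path is replaced by its values at the dyadic times, a point of the Polish space
  \<open>\<real>\<^bsup>\<nat> \<times> \<nat>\<^esup>\<close>. All Borel sets of \<open>C[0,\<infinity>)\<close> come from Borel sets there, and the set of dyadic restrictions of
  continuous functions is itself Borel (\<open>borel_cpath_skeleton\<close>, \<open>range_skeleton_borel\<close>). Let \<open>U\<close> be an upper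
  Borel set. By inner regularity the probability of \<open>U\<close> is a supremum over compact subsets \<open>K\<close>; the
  set of points above some element of \<open>K\<close> still lies in \<open>U\<close>, and by compactness it is a decreasing
  intersection of closed upper sets that each depend on finitely many coordinates. This reduces \<open>U\<close> to the
  finite-dimensional comparison (\<open>emeasure_upper_set_le\<close>). Integrating over the level sets of an
  increasing function, all of which are upper sets, finishes the proof (\<open>stoch_leI\<close>).

  Expectations are taken as nonnegative integrals with values in \<open>[0,\<infinity>]\<close>, so that the unbounded
  exponential weights raise no question of integrability.\<close>

section \<open>The transition density of the absolute value\<close>

text \<open>The ratio \<open>cosh (u y) / cosh (v y)\<close> increases in \<open>\<bar>y\<bar>\<close> when \<open>\<bar>v\<bar> \<le> \<bar>u\<bar>\<close>; this fact, cleared of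
  denominators, is the source of all likelihood ratio comparisons below. Turning products into sums reduces it to the monotonicity of \<open>cosh\<close> on \<open>[0,\<infinity>)\<close>.\<close>

lemma cosh_mult_cosh_le:
  fixes u v x y :: real
  assumes "\<bar>v\<bar> \<le> \<bar>u\<bar>" "\<bar>x\<bar> \<le> \<bar>y\<bar>"
  shows "cosh (u * x) * cosh (v * y) \<le> cosh (u * y) * cosh (v * x)"
proof -
  have product: "2 * (cosh p * cosh q) = cosh (p + q) + cosh (p - q)" for p q :: real
    by (simp add: cosh_add cosh_diff)
  have *: "cosh (u * x) * cosh (v * y) \<le> cosh (u * y) * cosh (v * x)"
    if "0 \<le> v" "v \<le> u" "0 \<le> x" "x \<le> y" for u v x y :: real
  proof -
    have "0 \<le> (u - v) * (y - x)" "0 \<le> (u + v) * (y - x)" "0 \<le> (u - v) * (y + x)" "0 \<le> u * x" "0 \<le> v * y"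
      using that by auto
    then have "u * x + v * y \<le> u * y + v * x" "\<bar>u * x - v * y\<bar> \<le> u * y - v * x" "0 \<le> u * x + v * y"
      by (auto simp: algebra_simps abs_le_iff)
    then have "cosh (u * x + v * y) \<le> cosh (u * y + v * x)"
      and "cosh \<bar>u * x - v * y\<bar> \<le> cosh (u * y - v * x)"
      by (intro cosh_real_nonneg_le_iff[THEN iffD2]; linarith)+
    then show ?thesis
      using product[of "u * x" "v * y"] product[of "u * y" "v * x"] by simp
  qed
  show ?thesis
    using *[of "\<bar>v\<bar>" "\<bar>u\<bar>" "\<bar>x\<bar>" "\<bar>y\<bar>"] assms by (simp flip: abs_mult)
qed

text \<open>Passing from \<open>p\<close> to \<open>q\<close> moves mass to where \<open>g\<close> is larger. Some level \<open>\<gamma>\<close> separates the values of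
  \<open>g\<close> on \<open>{q \<le> p}\<close> from those on \<open>{p < q}\<close>, so \<open>(g - \<gamma>) (q - p) \<ge> 0\<close> pointwise, and \<open>\<gamma>\<close> drops out on
  integration because both masses are one. The bound on \<open>g\<close> makes \<open>\<gamma>\<close> finite, hence cancellable.\<close>

lemma nn_integral_le_single_crossing:
  fixes p q g :: "'b \<Rightarrow> ennreal"
  assumes [measurable]: "p \<in> borel_measurable N" "q \<in> borel_measurable N" "g \<in> borel_measurable N"
    and p: "(\<integral>\<^sup>+y. p y \<partial>N) = 1" and q: "(\<integral>\<^sup>+y. q y \<partial>N) = 1"
    and bounded: "\<And>y. g y \<le> 1"
    and crossing: "\<And>y z. q y \<le> p y \<Longrightarrow> p z < q z \<Longrightarrow> g y \<le> g z"
  shows "(\<integral>\<^sup>+y. p y * g y \<partial>N) \<le> (\<integral>\<^sup>+y. q y * g y \<partial>N)"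
proof -
  define \<gamma> where "\<gamma> = (SUP y\<in>{y. q y \<le> p y}. g y)"
  have "\<gamma> \<le> 1"
    unfolding \<gamma>_def using bounded by (intro SUP_least)
  have exchange: "p y * g y + \<gamma> * q y \<le> q y * g y + \<gamma> * p y" for y
  proof (cases "q y \<le> p y")
    case True
    then obtain r where r: "p y = q y + r" "g y \<le> \<gamma>"
      unfolding \<gamma>_def by (metis (no_types, lifting) SUP_upper mem_Collect_eq le_iff_add)
    have "r * g y \<le> r * \<gamma>" using r by (intro mult_left_mono) auto
    with r show ?thesis
      by (simp add: algebra_simps add_left_mono)
  next
    case False
    then obtain r where r: "q y = p y + r"
      by (metis le_iff_add nle_le)
    have "\<gamma> \<le> g y"
      unfolding \<gamma>_def using False crossing by (intro SUP_least) auto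
    then have "r * \<gamma> \<le> r * g y" by (intro mult_left_mono) auto
    with r show ?thesis
      by (simp add: algebra_simps add_left_mono)
  qed
  have "(\<integral>\<^sup>+y. p y * g y \<partial>N) + \<gamma> = (\<integral>\<^sup>+y. p y * g y + \<gamma> * q y \<partial>N)"
    by (subst nn_integral_add) (auto simp: nn_integral_cmult q)
  also have "\<dots> \<le> (\<integral>\<^sup>+y. q y * g y + \<gamma> * p y \<partial>N)"
    by (intro nn_integral_mono exchange)
  also have "\<dots> = (\<integral>\<^sup>+y. q y * g y \<partial>N) + \<gamma>"
    by (subst nn_integral_add) (auto simp: nn_integral_cmult p)
  finally show ?thesis
    using \<open>\<gamma> \<le> 1\<close> by (metis ennreal_add_left_cancel_le add.commute ennreal_one_less_top less_le_trans not_le infinity_ennreal_def top.extremum_uniqueI)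
qed

text \<open>The transition density over a time step \<open>d\<close> of \<open>\<bar>B\<^sup>\<mu>\<bar>\<close> from \<open>\<bar>x\<bar>\<close>, spread evenly over \<open>y\<close> and \<open>- y\<close> to give
  a probability density on the whole line. Probabilistically, \<open>B\<^sup>\<mu>\<close> starts in \<open>x\<close> or \<open>- x\<close> with odds
  \<open>exp (\<mu> x) : exp (- \<mu> x)\<close>. The product form displays the dependence on \<open>y\<close> through \<open>cosh\<close> factors.\<close>

definition abs_kernel :: "real \<Rightarrow> real \<Rightarrow> real \<Rightarrow> real \<Rightarrow> real" where
  "abs_kernel d \<mu> x y = normal_density 0 (sqrt d) y * exp (- x\<^sup>2 / (2 * d) - \<mu>\<^sup>2 * d / 2)
     * cosh (x * y / d) * cosh (\<mu> * y) / cosh (\<mu> * x)"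

lemma abs_kernel_measurable [measurable (raw)]:
  assumes [measurable]: "f \<in> borel_measurable N" "g \<in> borel_measurable N"
  shows "(\<lambda>\<omega>. abs_kernel d \<mu> (f \<omega>) (g \<omega>)) \<in> borel_measurable N"
  unfolding abs_kernel_def cosh_def by measurable

text \<open>The Gaussian case of Girsanov's formula: the drift is absorbed by the change from the
  weight \<open>exp (- \<mu> x)\<close> before the step to \<open>exp (- \<mu> y)\<close> after it.\<close>

lemma normal_density_drift:
  assumes "d > 0"
  shows "normal_density 0 (sqrt d) (y - x - \<mu> * d) =
     exp (- \<mu> * x) * (exp (- \<mu>\<^sup>2 * d / 2) * normal_density 0 (sqrt d) (y - x) * exp (\<mu> * y))"
proof -
  have "- (y - x - \<mu> * d)\<^sup>2 / (2 * d) = - \<mu> * x + - \<mu>\<^sup>2 * d / 2 + - (y - x)\<^sup>2 / (2 * d) + \<mu> * y"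
    using assms by (simp add: field_simps power2_eq_square)
  then show ?thesis
    using assms by (simp add: normal_density_def mult_exp_exp mult.assoc mult.left_commute flip: exp_add)
qed

lemma normal_density_reflected:
  assumes "d > 0"
  shows "normal_density 0 (sqrt d) (y - x) + normal_density 0 (sqrt d) (y + x) =
     2 * normal_density 0 (sqrt d) y * exp (- x\<^sup>2 / (2 * d)) * cosh (x * y / d)"
proof -
  have "- (y - x)\<^sup>2 / (2 * d) = - y\<^sup>2 / (2 * d) + - x\<^sup>2 / (2 * d) + x * y / d"
    "- (y + x)\<^sup>2 / (2 * d) = - y\<^sup>2 / (2 * d) + - x\<^sup>2 / (2 * d) + - (x * y / d)"
    using assms by (simp_all add: field_simps power2_eq_square)
  then have "exp (- (y - x)\<^sup>2 / (2 * d)) + exp (- (y + x)\<^sup>2 / (2 * d)) =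
    2 * exp (- y\<^sup>2 / (2 * d)) * exp (- x\<^sup>2 / (2 * d)) * cosh (x * y / d)"
    unfolding cosh_field_def by (simp only: exp_add) (simp add: field_simps)
  then show ?thesis
    using assms by (simp add: normal_density_def flip: add_divide_distrib)
qed

lemma abs_kernel_eq:
  assumes "d > 0"
  shows "2 * cosh (\<mu> * x) * abs_kernel d \<mu> x y = exp (- \<mu>\<^sup>2 * d / 2) *
    (normal_density 0 (sqrt d) (y - x) + normal_density 0 (sqrt d) (y + x)) * cosh (\<mu> * y)"
  unfolding normal_density_reflected[OF assms] abs_kernel_def
  by (simp add: mult_ac flip: exp_add)

lemma abs_kernel_pos: "d > 0 \<Longrightarrow> abs_kernel d \<mu> x y > 0"
  by (simp add: abs_kernel_def normal_density_pos)

lemma abs_kernel_even: "abs_kernel d \<mu> \<bar>x\<bar> y = abs_kernel d \<mu> x y"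
  by (simp add: abs_kernel_def abs_if)

text \<open>The density is a mixture of four normal densities, with means \<open>\<plusminus> x \<plusminus> \<mu> d\<close>.\<close>

lemma abs_kernel_integral:
  assumes "d > 0"
  shows "(\<integral>\<^sup>+y. abs_kernel d \<mu> x y \<partial>lborel) = 1"
proof -
  let ?N = "\<lambda>m. normal_density m (sqrt d)"
  have N: "has_bochner_integral lborel (?N m) 1" for m
    using assms by (simp add: has_bochner_integral_iff)
  have *: "exp (\<mu> * x) * (?N (x + \<mu> * d) y + ?N (- x - \<mu> * d) y)
      + exp (- \<mu> * x) * (?N (x - \<mu> * d) y + ?N (- x + \<mu> * d) y) = 4 * cosh (\<mu> * x) * abs_kernel d \<mu> x y" for y
  proof -
    have shift: "?N m z = ?N 0 (z - m)" for m z
      by (simp add: normal_density_def)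
    let ?c = "exp (- \<mu>\<^sup>2 * d / 2)"
    have "?N (x + \<mu> * d) y = exp (- \<mu> * x) * (?c * ?N 0 (y - x) * exp (\<mu> * y))"
      "?N (- x - \<mu> * d) y = exp (- \<mu> * x) * (?c * ?N 0 (y + x) * exp (- \<mu> * y))"
      "?N (x - \<mu> * d) y = exp (\<mu> * x) * (?c * ?N 0 (y - x) * exp (- \<mu> * y))"
      "?N (- x + \<mu> * d) y = exp (\<mu> * x) * (?c * ?N 0 (y + x) * exp (\<mu> * y))"
      unfolding shift[of "x + \<mu> * d" y] shift[of "- x - \<mu> * d" y]
        shift[of "x - \<mu> * d" y] shift[of "- x + \<mu> * d" y]
      using normal_density_drift[OF assms, of y x \<mu>] normal_density_drift[OF assms, of y "-x" "-\<mu>"]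
        normal_density_drift[OF assms, of y x "-\<mu>"] normal_density_drift[OF assms, of y "-x" \<mu>]
      by (simp_all add: algebra_simps)
    then have "exp (\<mu> * x) * (?N (x + \<mu> * d) y + ?N (- x - \<mu> * d) y)
      + exp (- \<mu> * x) * (?N (x - \<mu> * d) y + ?N (- x + \<mu> * d) y)
      = ?c * (?N 0 (y - x) + ?N 0 (y + x)) * (exp (\<mu> * y) + exp (- \<mu> * y))"
      by (simp add: exp_minus field_simps)
    also have "\<dots> = 2 * (?c * (?N 0 (y - x) + ?N 0 (y + x)) * cosh (\<mu> * y))"
      by (simp add: cosh_field_def)
    also have "\<dots> = 2 * (2 * cosh (\<mu> * x) * abs_kernel d \<mu> x y)"
      unfolding abs_kernel_eq[OF assms] ..
    finally show ?thesis
      by simp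
  qed
  have "has_bochner_integral lborel (\<lambda>y. 1 / (4 * cosh (\<mu> * x)) *
     (exp (\<mu> * x) * (?N (x + \<mu> * d) y + ?N (- x - \<mu> * d) y)
      + exp (- \<mu> * x) * (?N (x - \<mu> * d) y + ?N (- x + \<mu> * d) y)))
     (1 / (4 * cosh (\<mu> * x)) * (exp (\<mu> * x) * (1 + 1) + exp (- \<mu> * x) * (1 + 1)))"
    by (intro has_bochner_integral_add has_bochner_integral_mult_right N)
  then have "has_bochner_integral lborel (abs_kernel d \<mu> x) (1 / (4 * cosh (\<mu> * x)) * (exp (\<mu> * x) * (1 + 1) + exp (- \<mu> * x) * (1 + 1)))"
    unfolding * by simp
  also have "1 / (4 * cosh (\<mu> * x)) * (exp (\<mu> * x) * (1 + 1) + exp (- \<mu> * x) * (1 + 1)) = (4 * cosh (\<mu> * x)) / (4 * cosh (\<mu> * x))"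
    by (simp add: cosh_field_def)
  also have "\<dots> = 1" by simp
  finally show ?thesis
    using abs_kernel_pos[OF assms] by (simp add: has_bochner_integral_iff nn_integral_eq_integral less_imp_le)
qed

lemma abs_kernel_likelihood_ratio:
  assumes "d > 0" "\<bar>a\<bar> \<le> \<bar>b\<bar>" "\<bar>x\<bar> \<le> \<bar>x'\<bar>" "\<bar>y\<bar> \<le> \<bar>z\<bar>"
  shows "abs_kernel d a x z * abs_kernel d b x' y \<le> abs_kernel d a x y * abs_kernel d b x' z"
proof -
  define C where "C = (\<lambda>y. cosh (x * y / d) * cosh (a * y))"
  define C' where "C' = (\<lambda>y. cosh (x' * y / d) * cosh (b * y))"
  define w where "w = normal_density 0 (sqrt d) y * normal_density 0 (sqrt d) z
     * exp (- x\<^sup>2 / (2 * d) - a\<^sup>2 * d / 2) * exp (- x'\<^sup>2 / (2 * d) - b\<^sup>2 * d / 2) / (cosh (a * x) * cosh (b * x'))"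
  have "w \<ge> 0" by (simp add: w_def)
  have "cosh (x' / d * y) * cosh (x / d * z) \<le> cosh (x' / d * z) * cosh (x / d * y)"
    using assms by (intro cosh_mult_cosh_le) (auto simp: divide_right_mono)
  moreover have "cosh (b * y) * cosh (a * z) \<le> cosh (b * z) * cosh (a * y)"
    using assms by (intro cosh_mult_cosh_le) auto
  ultimately have "(cosh (x' / d * y) * cosh (x / d * z)) * (cosh (b * y) * cosh (a * z))
      \<le> (cosh (x' / d * z) * cosh (x / d * y)) * (cosh (b * z) * cosh (a * y))"
    by (rule mult_mono) auto
  then have "C z * C' y \<le> C y * C' z"
    by (simp add: C_def C'_def mult_ac)
  then have "w * (C z * C' y) \<le> w * (C y * C' z)"
    using \<open>w \<ge> 0\<close> by (rule mult_left_mono)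
  then show ?thesis
    by (simp add: abs_kernel_def w_def C_def C'_def mult_ac)
qed

text \<open>The likelihood ratio of the two densities increases in \<open>\<bar>y\<bar>\<close>, so it crosses one
  at most once as \<open>\<bar>y\<bar>\<close> grows.\<close>

lemma abs_kernel_mono:
  fixes g :: "real \<Rightarrow> ennreal"
  assumes d: "d > 0" and "\<bar>a\<bar> \<le> \<bar>b\<bar>" "\<bar>x\<bar> \<le> \<bar>x'\<bar>"
    and [measurable]: "g \<in> borel_measurable borel"
    and bounded: "\<And>y. g y \<le> 1"
    and mono: "\<And>y z. \<bar>y\<bar> \<le> \<bar>z\<bar> \<Longrightarrow> g y \<le> g z"
  shows "(\<integral>\<^sup>+y. abs_kernel d a x y * g y \<partial>lborel) \<le> (\<integral>\<^sup>+y. abs_kernel d b x' y * g y \<partial>lborel)"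
proof (rule nn_integral_le_single_crossing)
  fix y z assume "ennreal (abs_kernel d b x' y) \<le> ennreal (abs_kernel d a x y)" "ennreal (abs_kernel d a x z) < ennreal (abs_kernel d b x' z)"
  then have *: "abs_kernel d b x' y \<le> abs_kernel d a x y" "abs_kernel d a x z < abs_kernel d b x' z"
    using abs_kernel_pos[OF d] by (auto simp: less_imp_le ennreal_less_iff)
  have "\<bar>y\<bar> \<le> \<bar>z\<bar>"
  proof (rule ccontr)
    assume "\<not> \<bar>y\<bar> \<le> \<bar>z\<bar>"
    then have "abs_kernel d a x y * abs_kernel d b x' z \<le> abs_kernel d a x z * abs_kernel d b x' y"
      using assms by (intro abs_kernel_likelihood_ratio) auto
    also have "\<dots> \<le> abs_kernel d a x z * abs_kernel d a x y"
      using * abs_kernel_pos[OF d] by (intro mult_left_mono) (auto simp: less_imp_le)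
    also have "\<dots> < abs_kernel d b x' z * abs_kernel d a x y"
      using * abs_kernel_pos[OF d] by (intro mult_strict_right_mono) auto
    finally show False by (simp add: mult.commute)
  qed
  then show "g y \<le> g z" by (rule mono)
qed (use assms abs_kernel_integral in auto)

section \<open>The drifted motion on a grid\<close>

text \<open>The coordinates beyond the last grid index \<open>n\<close> are set to \<open>0\<close>, so that all numbers of steps share one space
  of sequences and no step changes an earlier coordinate.\<close>

definition grid_path :: "(real \<Rightarrow> 'a \<Rightarrow> real) \<Rightarrow> real \<Rightarrow> real \<Rightarrow> nat \<Rightarrow> 'a \<Rightarrow> nat \<Rightarrow> real" where
  "grid_path B \<mu> d n \<omega> = (\<lambda>i. if i \<le> n then drift_BM B \<mu> (real i * d) \<omega> else 0)"

definition pointwise_abs :: "('i \<Rightarrow> real) \<Rightarrow> 'i \<Rightarrow> real" where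
  "pointwise_abs z = (\<lambda>i. \<bar>z i\<bar>)"

lemma measurable_pointwise_abs [measurable]:
  "pointwise_abs \<in> borel_measurable (borel :: (nat \<Rightarrow> real) measure)"
  unfolding pointwise_abs_def[abs_def]
  by (rule measurable_coordinatewise_then_product) measurable

lemma measurable_fun_update [measurable (raw)]:
  fixes f :: "'b \<Rightarrow> nat \<Rightarrow> real"
  assumes [measurable]: "f \<in> borel_measurable N" "g \<in> borel_measurable N"
  shows "(\<lambda>\<omega>. (f \<omega>)(k := g \<omega>)) \<in> borel_measurable N"
proof (rule measurable_coordinatewise_then_product)
  fix i
  have [measurable]: "(\<lambda>\<omega>. f \<omega> i) \<in> borel_measurable N"
    by (rule measurable_product_then_coordinatewise) simp
  show "(\<lambda>\<omega>. ((f \<omega>)(k := g \<omega>)) i) \<in> borel_measurable N"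
    by (cases "i = k") simp_all
qed

lemma (in brownian_motion) drift_BM_measurable [measurable (raw)]:
  "0 \<le> t \<Longrightarrow> drift_BM B \<mu> t \<in> borel_measurable M"
  using random_variable_BM[of t] unfolding drift_BM_def[abs_def] by measurable

lemma (in brownian_motion) grid_path_measurable [measurable]:
  "0 < d \<Longrightarrow> grid_path B \<mu> d n \<in> borel_measurable M"
  unfolding grid_path_def
  by (intro measurable_coordinatewise_then_product) auto

text \<open>The Markov property at a grid time. The past of the path is a measurable function of the first \<open>n\<close>
  increments. The last increment appears as a family over the singleton \<open>{n}\<close>, because \<open>indep_var\<close>
  relates two variables with values in the same type.\<close>

lemma (in brownian_motion) grid_path_step:
  fixes F :: "(nat \<Rightarrow> real) \<times> real \<Rightarrow> ennreal"
  assumes d: "d > 0" and F [measurable]: "F \<in> borel_measurable (borel \<Otimes>\<^sub>M borel)"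
  shows "(\<integral>\<^sup>+\<omega>. F (grid_path B \<mu> d n \<omega>, grid_path B \<mu> d (Suc n) \<omega> (Suc n)) \<partial>M) =
    (\<integral>\<^sup>+\<omega>. (\<integral>\<^sup>+y. normal_density 0 (sqrt d) (y - grid_path B \<mu> d n \<omega> n - \<mu> * d) *
       F (grid_path B \<mu> d n \<omega>, y) \<partial>lborel) \<partial>M)"
proof -
  define D where "D = (\<lambda>i \<omega>. B (real (Suc i) * d) \<omega> - B (real i * d) \<omega>)"
  define V where "V = (\<lambda>v :: nat \<Rightarrow> real. \<lambda>i. if i \<le> n then (\<Sum>j<i. v j) + \<mu> * (real i * d) else 0)"
  define S where "S = (\<lambda>J. PiM J (\<lambda>_ :: nat. borel :: real measure))"
  define R where "R = (\<lambda>J \<omega>. restrict (\<lambda>i. D i \<omega>) J)"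
  define L where "L = density lborel (\<lambda>y. ennreal (normal_density 0 (sqrt d) y))"
  have "indep_vars (\<lambda>_. borel) D {..<Suc n}"
    unfolding D_def using d
    by (intro indep_increments_BM[of "\<lambda>i. real i * d"]) (auto intro!: monoI mult_right_mono)
  from indep_var_restrict[OF this, of "{..<n}" "{n}"]
  have "indep_var (S {..<n}) (R {..<n}) (S {n}) (R {n})"
    unfolding S_def R_def by auto
  then have R [measurable]: "R {..<n} \<in> measurable M (S {..<n})" "R {n} \<in> measurable M (S {n})"
    and joint: "distr M (S {..<n}) (R {..<n}) \<Otimes>\<^sub>M distr M (S {n}) (R {n})
      = distr M (S {..<n} \<Otimes>\<^sub>M S {n}) (\<lambda>\<omega>. (R {..<n} \<omega>, R {n} \<omega>))"
    unfolding indep_var_distribution_eq by blast+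
  have V [measurable]: "V \<in> borel_measurable (S {..<n})"
    unfolding V_def S_def
  proof (rule measurable_coordinatewise_then_product)
    fix i
    show "(\<lambda>v. if i \<le> n then (\<Sum>j<i. v j) + \<mu> * (real i * d) else 0)
        \<in> borel_measurable (Pi\<^sub>M {..<n} (\<lambda>_. borel))"
      by (cases "i \<le> n") (auto intro!: borel_measurable_add borel_measurable_sum measurable_component_singleton)
  qed
  have last [measurable]: "(\<lambda>p. snd p n) \<in> borel_measurable (S {..<n} \<Otimes>\<^sub>M S {n})"
    unfolding S_def by (intro measurable_compose[OF measurable_snd] measurable_component_singleton) simp
  have V_last [measurable]: "(\<lambda>p. V (fst p) n) \<in> borel_measurable (S {..<n} \<Otimes>\<^sub>M S {n})"
    by (rule measurable_product_then_coordinatewise) measurable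
  interpret R: prob_space "distr M (S {n}) (R {n})"
    by (rule prob_space_distr) simp
  have "distributed M lborel (D n) (normal_density 0 (sqrt d))"
    using increment_BM[of "real n * d" "real (Suc n) * d"] d by (simp add: D_def algebra_simps)
  then have law: "distr M lborel (D n) = L"
    unfolding L_def by (rule distributed_distr_eq_density)
  have D_measurable [measurable]: "D n \<in> borel_measurable M"
    using \<open>distributed M lborel (D n) _\<close> by (auto dest: distributed_measurable)
  have path: "V (R {..<n} \<omega>) = grid_path B \<mu> d n \<omega>" if "\<omega> \<in> space M" for \<omega>
  proof
    fix i
    have "(\<Sum>j<i. R {..<n} \<omega> j) = B (real i * d) \<omega>" if "i \<le> n"
    proof -
      have "(\<Sum>j<i. R {..<n} \<omega> j) = (\<Sum>j<i. D j \<omega>)"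
        using that by (intro sum.cong) (auto simp: R_def)
      also have "\<dots> = B (real i * d) \<omega>"
        using sum_lessThan_telescope[of "\<lambda>j. B (real j * d) \<omega>" i] start_BM[OF \<open>\<omega> \<in> space M\<close>]
        by (simp add: D_def)
      finally show ?thesis .
    qed
    then show "V (R {..<n} \<omega>) i = grid_path B \<mu> d n \<omega> i"
      by (simp add: V_def grid_path_def drift_BM_def)
  qed
  have R_last: "R {n} \<omega> n = D n \<omega>" for \<omega>
    by (simp add: R_def)
  have next_value: "grid_path B \<mu> d (Suc n) \<omega> (Suc n) = grid_path B \<mu> d n \<omega> n + \<mu> * d + D n \<omega>" for \<omega>
    by (simp add: grid_path_def drift_BM_def D_def algebra_simps)
  define H where "H = (\<lambda>(v, w :: nat \<Rightarrow> real). F (V v, V v n + \<mu> * d + w n))"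
  have H [measurable]: "H \<in> borel_measurable (S {..<n} \<Otimes>\<^sub>M S {n})"
    unfolding H_def case_prod_beta by measurable
  have "(\<integral>\<^sup>+\<omega>. F (grid_path B \<mu> d n \<omega>, grid_path B \<mu> d (Suc n) \<omega> (Suc n)) \<partial>M)
      = (\<integral>\<^sup>+\<omega>. H (R {..<n} \<omega>, R {n} \<omega>) \<partial>M)"
    by (intro nn_integral_cong) (simp add: H_def path next_value R_last)
  also have "\<dots> = (\<integral>\<^sup>+z. H z \<partial>distr M (S {..<n} \<Otimes>\<^sub>M S {n}) (\<lambda>\<omega>. (R {..<n} \<omega>, R {n} \<omega>)))"
    by (subst nn_integral_distr) auto
  also have "\<dots> = (\<integral>\<^sup>+v. \<integral>\<^sup>+w. H (v, w) \<partial>distr M (S {n}) (R {n}) \<partial>distr M (S {..<n}) (R {..<n}))"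
    unfolding joint[symmetric] by (rule R.nn_integral_fst[symmetric]) simp
  also have "\<dots> = (\<integral>\<^sup>+\<omega>. \<integral>\<^sup>+w. H (R {..<n} \<omega>, w) \<partial>distr M (S {n}) (R {n}) \<partial>M)"
    by (subst nn_integral_distr) (auto intro!: R.borel_measurable_nn_integral)
  also have "\<dots> = (\<integral>\<^sup>+\<omega>. (\<integral>\<^sup>+y. normal_density 0 (sqrt d) (y - grid_path B \<mu> d n \<omega> n - \<mu> * d) *
       F (grid_path B \<mu> d n \<omega>, y) \<partial>lborel) \<partial>M)"
  proof (intro nn_integral_cong)
    fix \<omega> assume \<omega>: "\<omega> \<in> space M"
    let ?x = "grid_path B \<mu> d n \<omega>"
    have "R {..<n} \<omega> \<in> space (S {..<n})"
      by (rule measurable_space[OF R(1) \<omega>])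
    then have "(\<integral>\<^sup>+w. H (R {..<n} \<omega>, w) \<partial>distr M (S {n}) (R {n})) = (\<integral>\<^sup>+\<omega>'. H (R {..<n} \<omega>, R {n} \<omega>') \<partial>M)"
      by (subst nn_integral_distr) auto
    also have "\<dots> = (\<integral>\<^sup>+\<omega>'. F (?x, ?x n + \<mu> * d + D n \<omega>') \<partial>M)"
      by (simp add: H_def path \<omega> R_last)
    also have "\<dots> = (\<integral>\<^sup>+y. F (?x, ?x n + \<mu> * d + y) \<partial>L)"
      unfolding law[symmetric] by (subst nn_integral_distr) auto
    also have "\<dots> = (\<integral>\<^sup>+y. normal_density 0 (sqrt d) y * F (?x, ?x n + \<mu> * d + y) \<partial>lborel)"
      unfolding L_def by (subst nn_integral_density) auto
    also have "\<dots> = (\<integral>\<^sup>+y. normal_density 0 (sqrt d) (y - ?x n - \<mu> * d) * F (?x, y) \<partial>lborel)"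
      by (subst nn_integral_real_affine[where c = 1 and t = "- ?x n - \<mu> * d"]) (auto simp: algebra_simps)
    finally show "(\<integral>\<^sup>+w. H (R {..<n} \<omega>, w) \<partial>distr M (S {n}) (R {n})) = \<dots>" .
  qed
  finally show ?thesis .
qed

lemma nn_integral_lborel_uminus:
  fixes f :: "real \<Rightarrow> ennreal"
  assumes "f \<in> borel_measurable borel"
  shows "(\<integral>\<^sup>+y. f (- y) \<partial>lborel) = (\<integral>\<^sup>+y. f y \<partial>lborel)"
  using nn_integral_real_affine[of f "-1" 0] assms by simp

lemma nn_integral_ennreal_cmult:
  assumes "c \<ge> 0" and [measurable]: "f \<in> borel_measurable N" "h \<in> borel_measurable N"
    and "\<And>y. f y \<ge> 0"
  shows "(\<integral>\<^sup>+y. ennreal (c * f y) * h y \<partial>N) = ennreal c * (\<integral>\<^sup>+y. ennreal (f y) * h y \<partial>N)"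
  using assms by (simp add: ennreal_mult mult.assoc nn_integral_cmult)

lemma pointwise_abs_grid_path_Suc:
  "pointwise_abs (grid_path B \<mu> d (Suc n) \<omega>) =
    (pointwise_abs (grid_path B \<mu> d n \<omega>))(Suc n := \<bar>grid_path B \<mu> d (Suc n) \<omega> (Suc n)\<bar>)"
  by (auto simp: pointwise_abs_def grid_path_def)

text \<open>Under the tilted law with weight \<open>exp (- \<mu> X\<^sub>n)\<close> the process is a symmetric random walk, so its last position
  can change sign without affecting the absolute values. The step of the induction integrates out
  the last increment: the Gaussian tilt moves the weight back to time \<open>n\<close>, and the substitution \<open>y \<mapsto> - y\<close>
  trades the sign at time \<open>n + 1\<close> for the sign at time \<open>n\<close>.\<close>

lemma (in brownian_motion) grid_path_reflection:
  fixes H :: "(nat \<Rightarrow> real) \<times> real \<Rightarrow> ennreal"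
  assumes d: "d > 0" and H: "H \<in> borel_measurable (borel \<Otimes>\<^sub>M borel)"
  shows "(\<integral>\<^sup>+\<omega>. exp (- \<mu> * grid_path B \<mu> d n \<omega> n) *
      H (pointwise_abs (grid_path B \<mu> d n \<omega>), grid_path B \<mu> d n \<omega> n) \<partial>M) =
    (\<integral>\<^sup>+\<omega>. exp (- \<mu> * grid_path B \<mu> d n \<omega> n) *
      H (pointwise_abs (grid_path B \<mu> d n \<omega>), - grid_path B \<mu> d n \<omega> n) \<partial>M)"
  using H
proof (induction n arbitrary: H)
  case 0
  show ?case
    by (intro nn_integral_cong) (simp add: grid_path_def drift_BM_def start_BM)
next
  case (Suc n)
  note [measurable] = Suc.prems
  let ?x = "\<lambda>n \<omega>. grid_path B \<mu> d n \<omega> n" and ?a = "\<lambda>n \<omega>. pointwise_abs (grid_path B \<mu> d n \<omega>)"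
  define J where "J = (\<lambda>s (z, x). \<integral>\<^sup>+y. ennreal (exp (- \<mu>\<^sup>2 * d / 2) * normal_density 0 (sqrt d) (y - x))
    * H (z(Suc n := \<bar>y\<bar>), s * y) \<partial>lborel)"
  have J [measurable]: "J s \<in> borel_measurable (borel \<Otimes>\<^sub>M borel)" for s
    unfolding J_def case_prod_beta by measurable
  have step: "(\<integral>\<^sup>+\<omega>. exp (- \<mu> * ?x (Suc n) \<omega>) * H (?a (Suc n) \<omega>, s * ?x (Suc n) \<omega>) \<partial>M) =
      (\<integral>\<^sup>+\<omega>. exp (- \<mu> * ?x n \<omega>) * J s (?a n \<omega>, ?x n \<omega>) \<partial>M)" for s
  proof -
    have "(\<lambda>(z, y). ennreal (exp (- \<mu> * y)) * H ((pointwise_abs z)(Suc n := \<bar>y\<bar>), s * y))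
       \<in> borel_measurable (borel \<Otimes>\<^sub>M borel)"
      by measurable
    from grid_path_step[OF d this, of \<mu> n]
    have "(\<integral>\<^sup>+\<omega>. exp (- \<mu> * ?x (Suc n) \<omega>) * H (?a (Suc n) \<omega>, s * ?x (Suc n) \<omega>) \<partial>M) =
      (\<integral>\<^sup>+\<omega>. \<integral>\<^sup>+y. normal_density 0 (sqrt d) (y - ?x n \<omega> - \<mu> * d) *
        (ennreal (exp (- \<mu> * y)) * H ((?a n \<omega>)(Suc n := \<bar>y\<bar>), s * y)) \<partial>lborel \<partial>M)"
      by (simp add: pointwise_abs_grid_path_Suc)
    also have "\<dots> = (\<integral>\<^sup>+\<omega>. exp (- \<mu> * ?x n \<omega>) * J s (?a n \<omega>, ?x n \<omega>) \<partial>M)"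
    proof (intro nn_integral_cong)
      fix \<omega>
      let ?x = "?x n \<omega>" and ?a = "?a n \<omega>"
      have "(\<integral>\<^sup>+y. normal_density 0 (sqrt d) (y - ?x - \<mu> * d) *
          (ennreal (exp (- \<mu> * y)) * H (?a(Suc n := \<bar>y\<bar>), s * y)) \<partial>lborel) =
        (\<integral>\<^sup>+y. ennreal (exp (- \<mu> * ?x) * (exp (- \<mu>\<^sup>2 * d / 2) * normal_density 0 (sqrt d) (y - ?x))) *
          H (?a(Suc n := \<bar>y\<bar>), s * y) \<partial>lborel)"
      proof (intro nn_integral_cong)
        fix y
        have "exp (\<mu> * y) * exp (- \<mu> * y) = 1"
          by (simp flip: exp_add)
        then have "normal_density 0 (sqrt d) (y - ?x - \<mu> * d) * exp (- \<mu> * y) =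
            exp (- \<mu> * ?x) * (exp (- \<mu>\<^sup>2 * d / 2) * normal_density 0 (sqrt d) (y - ?x))"
          unfolding normal_density_drift[OF d] by (simp only: mult.assoc mult_1_right)
        then show "normal_density 0 (sqrt d) (y - ?x - \<mu> * d) *
            (ennreal (exp (- \<mu> * y)) * H (?a(Suc n := \<bar>y\<bar>), s * y)) =
          ennreal (exp (- \<mu> * ?x) * (exp (- \<mu>\<^sup>2 * d / 2) * normal_density 0 (sqrt d) (y - ?x))) *
            H (?a(Suc n := \<bar>y\<bar>), s * y)"
          by (metis ennreal_mult exp_ge_zero mult.assoc normal_density_nonneg)
      qed
      also have "\<dots> = exp (- \<mu> * ?x) * J s (?a, ?x)"
        unfolding J_def prod.case by (rule nn_integral_ennreal_cmult) auto
      finally show "(\<integral>\<^sup>+y. normal_density 0 (sqrt d) (y - ?x - \<mu> * d) *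
          (ennreal (exp (- \<mu> * y)) * H (?a(Suc n := \<bar>y\<bar>), s * y)) \<partial>lborel) = \<dots>" .
    qed
    finally show ?thesis .
  qed
  have "J 1 (z, - x) = J (- 1) (z, x)" for z x
    unfolding J_def prod.case
    by (subst nn_integral_lborel_uminus[symmetric])
       (auto intro!: nn_integral_cong simp: normal_density_def power2_commute add.commute)
  then show ?case
    using step[of 1] step[of "-1"] Suc.IH[OF J, of 1] by simp
qed

text \<open>The absolute values form a Markov chain by themselves. The two signs of \<open>X\<^sub>n\<close>
  are averaged with their conditional probabilities by means of the reflection identity, and what remains depends
  on \<open>\<bar>X\<^sub>n\<bar>\<close> only, since \<open>abs_kernel\<close> is even in \<open>x\<close>.\<close>

lemma (in brownian_motion) abs_grid_path_step:
  fixes F :: "(nat \<Rightarrow> real) \<Rightarrow> ennreal"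
  assumes d: "d > 0" and F [measurable]: "F \<in> borel_measurable borel"
  shows "(\<integral>\<^sup>+\<omega>. F (pointwise_abs (grid_path B \<mu> d (Suc n) \<omega>)) \<partial>M) =
    (\<integral>\<^sup>+\<omega>. (\<integral>\<^sup>+y. abs_kernel d \<mu> (grid_path B \<mu> d n \<omega> n) y *
       F ((pointwise_abs (grid_path B \<mu> d n \<omega>))(Suc n := \<bar>y\<bar>)) \<partial>lborel) \<partial>M)"
proof -
  let ?x = "\<lambda>\<omega>. grid_path B \<mu> d n \<omega> n" and ?a = "\<lambda>\<omega>. pointwise_abs (grid_path B \<mu> d n \<omega>)"
  let ?N = "normal_density 0 (sqrt d)" and ?c = "exp (- \<mu>\<^sup>2 * d / 2)"
  note [measurable] = grid_path_measurable[OF d]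
  have [measurable]: "?x \<in> borel_measurable M" "?a \<in> borel_measurable M"
    by (rule measurable_product_then_coordinatewise) measurable
  define k where "k = (\<lambda>(z, x). \<integral>\<^sup>+y. ennreal (?c * ?N (y - x) * exp (\<mu> * y)) * F (z(Suc n := \<bar>y\<bar>)) \<partial>lborel)"
  \<comment> \<open>\<open>s (- x)\<close> is the conditional probability that a path with \<open>\<bar>X\<^sub>n\<bar> = \<bar>x\<bar>\<close> sits in \<open>x\<close>.\<close>
  define s where "s = (\<lambda>x. exp (- \<mu> * x) / (2 * cosh (\<mu> * x)))"
  have k [measurable]: "k \<in> borel_measurable (borel \<Otimes>\<^sub>M borel)"
    unfolding k_def case_prod_beta by measurable
  have s [measurable]: "s \<in> borel_measurable borel"
    unfolding s_def cosh_def by measurable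
  have s_nonneg: "s x \<ge> 0" for x
    by (simp add: s_def)
  have s_sum: "s x + s (- x) = 1" for x
  proof -
    have "s x + s (- x) = (exp (- \<mu> * x) + exp (\<mu> * x)) / (2 * cosh (\<mu> * x))"
      by (simp add: s_def add_divide_distrib)
    also have "exp (- \<mu> * x) + exp (\<mu> * x) = 2 * cosh (\<mu> * x)"
      by (simp add: cosh_field_def)
    finally show ?thesis by simp
  qed
  have k_sum: "ennreal (1 / (2 * cosh (\<mu> * x))) * (k (z, x) + k (z, - x)) =
      (\<integral>\<^sup>+y. abs_kernel d \<mu> x y * F (z(Suc n := \<bar>y\<bar>)) \<partial>lborel)" for z x
  proof -
    define N2 where "N2 = (\<lambda>y. ?c * (?N (y - x) + ?N (y + x)))"
    have N2 [measurable]: "N2 \<in> borel_measurable borel" "\<And>y. N2 y \<ge> 0"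
      unfolding N2_def by (auto intro!: add_nonneg_nonneg)
    have N2_even: "N2 (- y) = N2 y" for y
      by (simp add: N2_def normal_density_def power2_commute add.commute)
    define I where "I = (\<integral>\<^sup>+y. ennreal (N2 y * exp (\<mu> * y)) * F (z(Suc n := \<bar>y\<bar>)) \<partial>lborel)"
    have "k (z, x) + k (z, - x) = I"
      unfolding k_def prod.case I_def N2_def
      by (subst nn_integral_add[symmetric])
         (auto intro!: nn_integral_cong simp: distrib_left distrib_right)
    have "I + I = (\<integral>\<^sup>+y. ennreal (N2 y * exp (\<mu> * y)) * F (z(Suc n := \<bar>y\<bar>)) \<partial>lborel)
        + (\<integral>\<^sup>+y. ennreal (N2 y * exp (- \<mu> * y)) * F (z(Suc n := \<bar>y\<bar>)) \<partial>lborel)"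
      unfolding I_def
      by (subst (2) nn_integral_lborel_uminus[symmetric]) (auto simp: N2_even)
    also have "\<dots> = (\<integral>\<^sup>+y. ennreal (N2 y * exp (\<mu> * y) + N2 y * exp (- \<mu> * y)) * F (z(Suc n := \<bar>y\<bar>)) \<partial>lborel)"
      using N2(2) by (subst nn_integral_add[symmetric])
         (auto intro!: nn_integral_cong simp: distrib_right)
    also have "\<dots> = (\<integral>\<^sup>+y. ennreal (4 * cosh (\<mu> * x) * abs_kernel d \<mu> x y) * F (z(Suc n := \<bar>y\<bar>)) \<partial>lborel)"
    proof (intro nn_integral_cong arg_cong2[of _ _ _ _ "(*)"] arg_cong[of _ _ ennreal] refl)
      fix y
      have "N2 y * exp (\<mu> * y) + N2 y * exp (- \<mu> * y) = 2 * (N2 y * cosh (\<mu> * y))"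
        by (simp add: cosh_field_def distrib_left)
      also have "\<dots> = 2 * (2 * cosh (\<mu> * x) * abs_kernel d \<mu> x y)"
        unfolding abs_kernel_eq[OF d] N2_def ..
      finally show "N2 y * exp (\<mu> * y) + N2 y * exp (- \<mu> * y) = 4 * cosh (\<mu> * x) * abs_kernel d \<mu> x y"
        by simp
    qed
    also have "\<dots> = ennreal (4 * cosh (\<mu> * x)) * (\<integral>\<^sup>+y. abs_kernel d \<mu> x y * F (z(Suc n := \<bar>y\<bar>)) \<partial>lborel)"
      using abs_kernel_pos[OF d] by (intro nn_integral_ennreal_cmult) (auto simp: less_imp_le)
    finally have "ennreal (1 / (4 * cosh (\<mu> * x))) * (I + I) =
        ennreal (1 / (4 * cosh (\<mu> * x)) * (4 * cosh (\<mu> * x))) * (\<integral>\<^sup>+y. abs_kernel d \<mu> x y * F (z(Suc n := \<bar>y\<bar>)) \<partial>lborel)"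
      by (subst ennreal_mult) (auto simp: mult.assoc)
    also have "1 / (4 * cosh (\<mu> * x)) * (4 * cosh (\<mu> * x)) = 1"
      by simp
    also have "ennreal (1 / (4 * cosh (\<mu> * x))) * (I + I) =
        ennreal (1 / (4 * cosh (\<mu> * x)) + 1 / (4 * cosh (\<mu> * x))) * I"
      by (subst ennreal_plus) (auto simp: distrib_left distrib_right)
    finally show ?thesis
      using \<open>k (z, x) + k (z, - x) = I\<close> by (simp add: fun_upd_def)
  qed
  have "(\<lambda>(z, y). F ((pointwise_abs z)(Suc n := \<bar>y\<bar>))) \<in> borel_measurable (borel \<Otimes>\<^sub>M borel)"
    by measurable
  from grid_path_step[OF d this, of \<mu> n]
  have "(\<integral>\<^sup>+\<omega>. F (pointwise_abs (grid_path B \<mu> d (Suc n) \<omega>)) \<partial>M) =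
    (\<integral>\<^sup>+\<omega>. \<integral>\<^sup>+y. ?N (y - ?x \<omega> - \<mu> * d) * F ((?a \<omega>)(Suc n := \<bar>y\<bar>)) \<partial>lborel \<partial>M)"
    by (simp add: pointwise_abs_grid_path_Suc)
  also have "\<dots> = (\<integral>\<^sup>+\<omega>. exp (- \<mu> * ?x \<omega>) * k (?a \<omega>, ?x \<omega>) \<partial>M)"
    unfolding normal_density_drift[OF d] k_def prod.case
    by (intro nn_integral_cong nn_integral_ennreal_cmult) auto
  also have "\<dots> = (\<integral>\<^sup>+\<omega>. exp (- \<mu> * ?x \<omega>) * (ennreal (s (- ?x \<omega>)) * k (?a \<omega>, ?x \<omega>))
      + exp (- \<mu> * ?x \<omega>) * (ennreal (s (?x \<omega>)) * k (?a \<omega>, ?x \<omega>)) \<partial>M)"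
  proof (intro nn_integral_cong)
    fix \<omega>
    have "ennreal (s (- ?x \<omega>)) + ennreal (s (?x \<omega>)) = 1"
      using s_nonneg s_sum[of "?x \<omega>"] by (simp add: add.commute flip: ennreal_plus)
    then show "exp (- \<mu> * ?x \<omega>) * k (?a \<omega>, ?x \<omega>) = exp (- \<mu> * ?x \<omega>) * (ennreal (s (- ?x \<omega>)) * k (?a \<omega>, ?x \<omega>))
      + exp (- \<mu> * ?x \<omega>) * (ennreal (s (?x \<omega>)) * k (?a \<omega>, ?x \<omega>))"
      by (simp flip: distrib_left distrib_right)
  qed
  also have "\<dots> = (\<integral>\<^sup>+\<omega>. exp (- \<mu> * ?x \<omega>) * (ennreal (s (- ?x \<omega>)) * k (?a \<omega>, ?x \<omega>)) \<partial>M)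
      + (\<integral>\<^sup>+\<omega>. exp (- \<mu> * ?x \<omega>) * (ennreal (s (?x \<omega>)) * k (?a \<omega>, ?x \<omega>)) \<partial>M)"
    by (intro nn_integral_add) measurable
  also have "(\<integral>\<^sup>+\<omega>. exp (- \<mu> * ?x \<omega>) * (ennreal (s (?x \<omega>)) * k (?a \<omega>, ?x \<omega>)) \<partial>M)
     = (\<integral>\<^sup>+\<omega>. exp (- \<mu> * ?x \<omega>) * (ennreal (s (- ?x \<omega>)) * k (?a \<omega>, - ?x \<omega>)) \<partial>M)"
  proof -
    have "(\<lambda>(z, x). ennreal (s x) * k (z, x)) \<in> borel_measurable (borel \<Otimes>\<^sub>M borel)"
      by measurable
    from grid_path_reflection[OF d this, of \<mu> n] show ?thesis by simp
  qed
  also have "(\<integral>\<^sup>+\<omega>. exp (- \<mu> * ?x \<omega>) * (ennreal (s (- ?x \<omega>)) * k (?a \<omega>, ?x \<omega>)) \<partial>M) + \<dots>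
     = (\<integral>\<^sup>+\<omega>. exp (- \<mu> * ?x \<omega>) * (ennreal (s (- ?x \<omega>)) * k (?a \<omega>, ?x \<omega>)) +
         exp (- \<mu> * ?x \<omega>) * (ennreal (s (- ?x \<omega>)) * k (?a \<omega>, - ?x \<omega>)) \<partial>M)"
    by (intro nn_integral_add[symmetric]) measurable
  also have "\<dots> = (\<integral>\<^sup>+\<omega>. ennreal (1 / (2 * cosh (\<mu> * ?x \<omega>))) * (k (?a \<omega>, ?x \<omega>) + k (?a \<omega>, - ?x \<omega>)) \<partial>M)"
  proof (intro nn_integral_cong)
    fix \<omega>
    have "exp (- \<mu> * ?x \<omega>) * s (- ?x \<omega>) = 1 / (2 * cosh (\<mu> * ?x \<omega>))"
      by (simp add: s_def flip: exp_add)
    then have "ennreal (exp (- \<mu> * ?x \<omega>)) * ennreal (s (- ?x \<omega>)) = ennreal (1 / (2 * cosh (\<mu> * ?x \<omega>)))"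
      using s_nonneg by (metis ennreal_mult exp_ge_zero)
    then show "exp (- \<mu> * ?x \<omega>) * (ennreal (s (- ?x \<omega>)) * k (?a \<omega>, ?x \<omega>)) +
         exp (- \<mu> * ?x \<omega>) * (ennreal (s (- ?x \<omega>)) * k (?a \<omega>, - ?x \<omega>)) =
        ennreal (1 / (2 * cosh (\<mu> * ?x \<omega>))) * (k (?a \<omega>, ?x \<omega>) + k (?a \<omega>, - ?x \<omega>))"
      by (simp add: distrib_left flip: mult.assoc)
  qed
  finally show ?thesis
    unfolding k_sum .
qed

text \<open>The stochastic order of the finite-dimensional distributions. One transition with the smaller drift preserves
  increasing functions, which the induction hypothesis needs, and exchanging the drift in the
  last transition can only increase the value.\<close>

theorem (in brownian_motion) abs_grid_path_mono_drift:
  fixes F :: "(nat \<Rightarrow> real) \<Rightarrow> ennreal"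
  assumes d: "d > 0" and ab: "\<bar>a\<bar> \<le> \<bar>b\<bar>"
    and "F \<in> borel_measurable borel" "mono F" "\<And>z. F z \<le> 1"
  shows "(\<integral>\<^sup>+\<omega>. F (pointwise_abs (grid_path B a d n \<omega>)) \<partial>M) \<le>
    (\<integral>\<^sup>+\<omega>. F (pointwise_abs (grid_path B b d n \<omega>)) \<partial>M)"
  using assms(3-)
proof (induction n arbitrary: F)
  case 0
  have "grid_path B a d 0 = grid_path B b d 0"
    by (auto simp: grid_path_def drift_BM_def fun_eq_iff)
  then show ?case by simp
next
  case (Suc n)
  note [measurable] = Suc.prems(1)
  \<comment> \<open>The truncation at \<open>0\<close> does not affect absolute values, and it makes \<open>P\<close> increasing on all sequences:
    the density is ordered by the absolute value of its starting point.\<close>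
  define P where "P = (\<lambda>\<mu> z. \<integral>\<^sup>+y. abs_kernel d \<mu> (max 0 (z n)) y * F (z(Suc n := \<bar>y\<bar>)) \<partial>lborel)"
  have [measurable]: "(\<lambda>p. fst p n) \<in> borel_measurable ((borel :: (nat \<Rightarrow> real) measure) \<Otimes>\<^sub>M lborel)"
    by (rule measurable_product_then_coordinatewise) (simp add: measurable_lborel1)
  have P [measurable]: "P \<mu> \<in> borel_measurable borel" for \<mu>
    unfolding P_def by measurable
  have F_mono: "F u \<le> F v" if "u \<le> v" for u v
    using \<open>mono F\<close> that by (rule monoD)
  have step: "(\<integral>\<^sup>+\<omega>. F (pointwise_abs (grid_path B \<mu> d (Suc n) \<omega>)) \<partial>M) =
      (\<integral>\<^sup>+\<omega>. P \<mu> (pointwise_abs (grid_path B \<mu> d n \<omega>)) \<partial>M)" for \<mu>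
    unfolding abs_grid_path_step[OF d Suc.prems(1)] P_def
    by (simp add: pointwise_abs_def abs_kernel_even)
  have P_kern: "P \<mu> z \<le> P \<mu>' z'" if "\<bar>\<mu>\<bar> \<le> \<bar>\<mu>'\<bar>" "z \<le> z'" for \<mu> \<mu>' z z'
  proof -
    have "z n \<le> z' n" using that by (simp add: le_fun_def)
    then have x: "\<bar>max 0 (z n)\<bar> \<le> \<bar>max 0 (z' n)\<bar>" by auto
    have "P \<mu> z \<le> (\<integral>\<^sup>+y. abs_kernel d \<mu>' (max 0 (z' n)) y * F (z(Suc n := \<bar>y\<bar>)) \<partial>lborel)"
      unfolding P_def using Suc.prems(3)
      by (intro abs_kernel_mono[OF d that(1) x]) (auto intro!: F_mono simp: le_fun_def)
    also have "\<dots> \<le> P \<mu>' z'"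
      unfolding P_def using that by (intro nn_integral_mono mult_left_mono F_mono) (auto simp: le_fun_def)
    finally show ?thesis .
  qed
  have P_le: "P \<mu> z \<le> 1" for \<mu> z
  proof -
    have "P \<mu> z \<le> (\<integral>\<^sup>+y. ennreal (abs_kernel d \<mu> (max 0 (z n)) y) * 1 \<partial>lborel)"
      unfolding P_def using Suc.prems by (intro nn_integral_mono mult_left_mono) auto
    then show ?thesis by (simp add: abs_kernel_integral[OF d])
  qed
  have "(\<integral>\<^sup>+\<omega>. F (pointwise_abs (grid_path B a d (Suc n) \<omega>)) \<partial>M) =
      (\<integral>\<^sup>+\<omega>. P a (pointwise_abs (grid_path B a d n \<omega>)) \<partial>M)"
    by (rule step)
  also have "\<dots> \<le> (\<integral>\<^sup>+\<omega>. P a (pointwise_abs (grid_path B b d n \<omega>)) \<partial>M)"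
    using P_kern P_le by (intro Suc.IH) (auto intro: monoI)
  also have "\<dots> \<le> (\<integral>\<^sup>+\<omega>. P b (pointwise_abs (grid_path B b d n \<omega>)) \<partial>M)"
    using ab by (intro nn_integral_mono P_kern) auto
  also have "\<dots> = (\<integral>\<^sup>+\<omega>. F (pointwise_abs (grid_path B b d (Suc n) \<omega>)) \<partial>M)"
    by (rule step[symmetric])
  finally show ?case .
qed

section \<open>Paths as families of dyadic values\<close>

definition dyadic :: "nat \<times> nat \<Rightarrow> real" where
  "dyadic p = real (fst p) / 2 ^ snd p"

definition skeleton :: "cpath \<Rightarrow> nat \<times> nat \<Rightarrow> real" where
  "skeleton x p = eval_path x (dyadic p)"

definition dyadic_below :: "real \<Rightarrow> nat \<Rightarrow> nat \<times> nat" where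
  "dyadic_below t j = (nat \<lfloor>t * 2 ^ j\<rfloor>, j)"

lemma dyadic_nonneg [simp]: "0 \<le> dyadic p"
  by (simp add: dyadic_def)

lemma dyadic_below:
  assumes "t \<ge> 0"
  shows "dyadic (dyadic_below t j) \<le> t" "t < dyadic (dyadic_below t j) + 1 / 2 ^ j"
proof -
  have "real (nat \<lfloor>t * 2 ^ j\<rfloor>) = of_int \<lfloor>t * 2 ^ j\<rfloor>"
    using assms by simp
  then have "real (nat \<lfloor>t * 2 ^ j\<rfloor>) \<le> t * 2 ^ j" "t * 2 ^ j < real (nat \<lfloor>t * 2 ^ j\<rfloor>) + 1"
    by linarith+
  then show "dyadic (dyadic_below t j) \<le> t" "t < dyadic (dyadic_below t j) + 1 / 2 ^ j"
    by (simp_all add: dyadic_def dyadic_below_def field_simps)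
qed

lemma power_half_tendsto: "(\<lambda>j. 1 / 2 ^ j :: real) \<longlonglongrightarrow> 0"
  using LIMSEQ_power_zero[of "1 / 2 :: real"] by (simp add: power_divide)

lemma ex_power_half_less: "e > 0 \<Longrightarrow> \<exists>n. 1 / 2 ^ n < (e :: real)"
  using order_tendstoD(2)[OF power_half_tendsto] by (auto simp: eventually_sequentially)

lemma dyadic_below_tendsto:
  assumes "t \<ge> 0"
  shows "(\<lambda>j. dyadic (dyadic_below t j)) \<longlonglongrightarrow> t"
proof (rule tendsto_sandwich[of "\<lambda>j. t - 1 / 2 ^ j" _ _ "\<lambda>_. t"])
  show "(\<lambda>j. t - 1 / 2 ^ j) \<longlonglongrightarrow> t"
    using tendsto_diff[OF tendsto_const[of t] power_half_tendsto] by simp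
  show "\<forall>\<^sub>F j in sequentially. t - 1 / 2 ^ j \<le> dyadic (dyadic_below t j)"
    using dyadic_below(2)[OF assms] by (auto intro!: always_eventually simp: less_imp_le diff_le_eq)
qed (use dyadic_below(1)[OF assms] in auto)

lemma continuous_on_eval_path: "continuous_on {0..} (eval_path x)"
  using eval_path[of x] by simp

lemma skeleton_below_tendsto:
  assumes "t \<ge> 0"
  shows "(\<lambda>j. skeleton x (dyadic_below t j)) \<longlonglongrightarrow> eval_path x t"
  unfolding skeleton_def
  using assms by (intro continuous_on_tendsto_compose[OF continuous_on_eval_path dyadic_below_tendsto]) auto

lemma skeleton_le_iff: "skeleton x \<le> skeleton y \<longleftrightarrow> x \<le> y"
proof
  assume "skeleton x \<le> skeleton y"
  then show "x \<le> y"
    unfolding less_eq_cpath_def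
    using LIMSEQ_le[OF skeleton_below_tendsto skeleton_below_tendsto] by (metis le_funD)
qed (simp add: le_fun_def less_eq_cpath_def skeleton_def)

text \<open>A modulus of continuity, expressed through dyadic values: up to time \<open>N\<close>, moving by at most \<open>2\<^bsup>-m\<^esup>\<close> changes
  the value by at most \<open>2\<^bsup>-n\<^esup>\<close>. As \<open>dyadic\<close> is not injective, these conditions also
  force equal values at different codes of the same time.\<close>

definition osc :: "nat \<Rightarrow> nat \<Rightarrow> nat \<Rightarrow> (nat \<times> nat \<Rightarrow> real) set" where
  "osc N n m = {z. \<forall>p q. dyadic p \<le> N \<longrightarrow> dyadic q \<le> N \<longrightarrow> \<bar>dyadic p - dyadic q\<bar> \<le> 1 / 2 ^ m \<longrightarrow>
     \<bar>z p - z q\<bar> \<le> 1 / 2 ^ n}"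

lemma oscD:
  "z \<in> osc N n m \<Longrightarrow> dyadic p \<le> N \<Longrightarrow> dyadic q \<le> N \<Longrightarrow> \<bar>dyadic p - dyadic q\<bar> \<le> 1 / 2 ^ m \<Longrightarrow>
    \<bar>z p - z q\<bar> \<le> 1 / 2 ^ n"
  unfolding osc_def by blast

lemma closed_osc: "closed (osc N n m)"
  unfolding osc_def
  by (intro closed_Collect_all closed_Collect_imp open_Collect_const closed_Collect_le)
     (auto intro!: continuous_intros continuous_on_product_coordinates)

lemma skeleton_mem_osc: "\<exists>m. skeleton x \<in> osc N n m"
proof -
  have "uniformly_continuous_on {0..real N} (eval_path x)"
    by (intro compact_uniformly_continuous continuous_on_subset[OF continuous_on_eval_path]) auto
  then obtain \<delta> where \<delta>: "\<delta> > 0"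
    "\<And>s t. s \<in> {0..real N} \<Longrightarrow> t \<in> {0..real N} \<Longrightarrow> dist s t < \<delta> \<Longrightarrow> dist (eval_path x s) (eval_path x t) < 1 / 2 ^ n"
    unfolding uniformly_continuous_on_def by (metis zero_less_divide_1_iff zero_less_numeral zero_less_power)
  obtain m where "1 / 2 ^ m < \<delta>"
    using ex_power_half_less[OF \<delta>(1)] by blast
  then have "skeleton x \<in> osc N n m"
    using \<delta>(2) by (auto simp: osc_def skeleton_def dist_real_def intro!: less_imp_le)
  then show ?thesis ..
qed

text \<open>A family of dyadic values extends to a continuous function exactly if it is uniformly continuous on bounded sets
  of times. The extension is the limit along dyadic approximations from below.\<close>

lemma range_skeleton: "range skeleton = (\<Inter>N n. \<Union>m. osc N n m)"
proof
  show "range skeleton \<subseteq> (\<Inter>N n. \<Union>m. osc N n m)"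
    using skeleton_mem_osc by auto
  show "(\<Inter>N n. \<Union>m. osc N n m) \<subseteq> range skeleton"
  proof
    fix z assume z: "z \<in> (\<Inter>N n. \<Union>m. osc N n m)"
    define x where "x t = lim (\<lambda>j. z (dyadic_below t j))" for t
    have x: "(\<lambda>j. z (dyadic_below t j)) \<longlonglongrightarrow> x t" if "t \<ge> 0" for t
    proof -
      have "Cauchy (\<lambda>j. z (dyadic_below t j))"
      proof (rule metric_CauchyI)
        fix e :: real assume "e > 0"
        then obtain n where n: "1 / 2 ^ n < e" using ex_power_half_less by blast
        obtain N :: nat where N: "t \<le> N" using real_arch_simple by blast
        obtain m where m: "z \<in> osc N n m" using z by blast
        have "dist (z (dyadic_below t i)) (z (dyadic_below t j)) < e" if "i \<ge> m" "j \<ge> m" for i j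
        proof -
          have "1 / 2 ^ i \<le> (1 / 2 ^ m :: real)" "1 / 2 ^ j \<le> (1 / 2 ^ m :: real)"
            using that by (auto intro!: divide_left_mono power_increasing)
          then have "\<bar>dyadic (dyadic_below t i) - dyadic (dyadic_below t j)\<bar> \<le> 1 / 2 ^ m"
            using dyadic_below[OF \<open>t \<ge> 0\<close>, of i] dyadic_below[OF \<open>t \<ge> 0\<close>, of j] by linarith
          then have "\<bar>z (dyadic_below t i) - z (dyadic_below t j)\<bar> \<le> 1 / 2 ^ n"
            using N dyadic_below(1)[OF \<open>t \<ge> 0\<close>] by (intro oscD[OF m]) (auto intro: order_trans)
          with n show ?thesis by (simp add: dist_real_def)
        qed
        then show "\<exists>M. \<forall>i\<ge>M. \<forall>j\<ge>M. dist (z (dyadic_below t i)) (z (dyadic_below t j)) < e"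
          by blast
      qed
      then show ?thesis
        unfolding x_def by (simp add: Cauchy_convergent_iff convergent_LIMSEQ_iff)
    qed
    have close: "\<bar>x s - x t\<bar> \<le> 1 / 2 ^ n"
      if m: "z \<in> osc N n m" and st: "s \<ge> 0" "t \<ge> 0" "s \<le> N" "t \<le> N" "\<bar>s - t\<bar> \<le> 1 / 2 ^ Suc m" for N n m s t
    proof (rule LIMSEQ_le_const2)
      show "(\<lambda>j. \<bar>z (dyadic_below s j) - z (dyadic_below t j)\<bar>) \<longlonglongrightarrow> \<bar>x s - x t\<bar>"
        by (intro tendsto_rabs tendsto_diff x st)
      have "\<bar>z (dyadic_below s j) - z (dyadic_below t j)\<bar> \<le> 1 / 2 ^ n" if "j \<ge> Suc m" for j
      proof (rule oscD[OF m])
        have "1 / 2 ^ j \<le> (1 / 2 ^ Suc m :: real)"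
          using that by (intro divide_left_mono power_increasing) auto
        moreover have "1 / 2 ^ m = 1 / 2 ^ Suc m + (1 / 2 ^ Suc m :: real)" by simp
        ultimately show "\<bar>dyadic (dyadic_below s j) - dyadic (dyadic_below t j)\<bar> \<le> 1 / 2 ^ m"
          using dyadic_below[OF st(1), of j] dyadic_below[OF st(2), of j] st(5) by linarith
      qed (use dyadic_below(1)[OF st(1)] dyadic_below(1)[OF st(2)] st in \<open>auto intro: order_trans\<close>)
      then show "\<exists>j0. \<forall>j\<ge>j0. \<bar>z (dyadic_below s j) - z (dyadic_below t j)\<bar> \<le> 1 / 2 ^ n" by blast
    qed
    have "continuous_on {0..} x"
      unfolding continuous_on_iff
    proof (intro ballI allI impI)
      fix t e :: real assume t: "t \<in> {0..}" and "e > 0"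
      obtain n where n: "1 / 2 ^ n < e" using ex_power_half_less[OF \<open>e > 0\<close>] by blast
      obtain N :: nat where N: "t + 1 \<le> N" using real_arch_simple by blast
      obtain m where m: "z \<in> osc N n m" using z by blast
      have "dist (x s) (x t) < e" if "s \<in> {0..}" "dist s t < 1 / 2 ^ Suc m" for s
      proof -
        have "1 / 2 ^ Suc m \<le> (1 :: real)"
          by (simp add: divide_le_eq_1 one_le_power del: power_Suc)
        then have "\<bar>s - t\<bar> \<le> 1"
          using that(2) unfolding dist_real_def by linarith
        then have "\<bar>x s - x t\<bar> \<le> 1 / 2 ^ n"
          using that t N by (intro close[OF m]) (auto simp: dist_real_def abs_less_iff)
        with n show ?thesis by (simp add: dist_real_def)
      qed
      then show "\<exists>\<delta>>0. \<forall>s\<in>{0..}. dist s t < \<delta> \<longrightarrow> dist (x s) (x t) < e"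
        by (intro exI[of _ "1 / 2 ^ Suc m"]) auto
    qed
    then have "continuous_on {0..} (restrict x {0..})"
      by (rule continuous_on_eq) simp
    then have eval: "eval_path (Path (restrict x {0..})) t = x t" if "t \<ge> 0" for t
      using that by (subst Path_inverse) auto
    have "x (dyadic p) = z p" for p
    proof (rule LIMSEQ_unique[OF x])
      show "(\<lambda>j. z (dyadic_below (dyadic p) j)) \<longlonglongrightarrow> z p"
      proof (rule LIMSEQ_I)
        fix e :: real assume "e > 0"
        then obtain n where n: "1 / 2 ^ n < e" using ex_power_half_less by blast
        obtain N :: nat where N: "dyadic p \<le> N" using real_arch_simple by blast
        obtain m where m: "z \<in> osc N n m" using z by blast
        have "norm (z (dyadic_below (dyadic p) j) - z p) < e" if "j \<ge> m" for j
        proof -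
          have "1 / 2 ^ j \<le> (1 / 2 ^ m :: real)"
            using that by (intro divide_left_mono power_increasing) auto
          then have "\<bar>z (dyadic_below (dyadic p) j) - z p\<bar> \<le> 1 / 2 ^ n"
            using N dyadic_below[of "dyadic p" j] by (intro oscD[OF m]) auto
          with n show ?thesis by simp
        qed
        then show "\<exists>j0. \<forall>j\<ge>j0. norm (z (dyadic_below (dyadic p) j) - z p) < e" by blast
      qed
    qed simp
    then have "skeleton (Path (restrict x {0..})) = z"
      by (auto simp: skeleton_def eval)
    then show "z \<in> range skeleton" by blast
  qed
qed

lemma range_skeleton_borel: "range skeleton \<in> sets borel"
  unfolding range_skeleton by (intro sets.countable_INT'' sets.countable_UN) (auto intro: borel_closed closed_osc)

lemma osc_eval_path:
  fixes t :: real
  assumes "skeleton x \<in> osc N n m" "0 \<le> t" "t \<le> N"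
  shows "\<bar>eval_path x t - skeleton x (dyadic_below t m)\<bar> \<le> 1 / 2 ^ n"
proof (rule LIMSEQ_le_const2)
  show "(\<lambda>j. \<bar>skeleton x (dyadic_below t j) - skeleton x (dyadic_below t m)\<bar>)
      \<longlonglongrightarrow> \<bar>eval_path x t - skeleton x (dyadic_below t m)\<bar>"
    using assms by (intro tendsto_rabs tendsto_diff skeleton_below_tendsto tendsto_const)
  have "\<bar>skeleton x (dyadic_below t j) - skeleton x (dyadic_below t m)\<bar> \<le> 1 / 2 ^ n" if "j \<ge> m" for j
  proof (rule oscD[OF assms(1)])
    have "1 / 2 ^ j \<le> (1 / 2 ^ m :: real)"
      using that by (intro divide_left_mono power_increasing) auto
    then show "\<bar>dyadic (dyadic_below t j) - dyadic (dyadic_below t m)\<bar> \<le> 1 / 2 ^ m"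
      using dyadic_below[OF assms(2), of j] dyadic_below[OF assms(2), of m] by linarith
  qed (use dyadic_below(1)[OF assms(2)] assms(3) in \<open>auto intro: order_trans\<close>)
  then show "\<exists>j0. \<forall>j\<ge>j0. \<bar>skeleton x (dyadic_below t j) - skeleton x (dyadic_below t m)\<bar> \<le> 1 / 2 ^ n"
    by blast
qed

text \<open>A Lindelof argument without a countable dense set of paths. Once the modulus of continuity is prescribed,
  closeness on a finite grid implies uniform closeness; the possibly uncountable union over the centres \<open>x\<close>
  takes place among the finite-grid conditions, where it is a union of open sets. Only the countably many scales
  \<open>N, n, m\<close> remain.\<close>

lemma open_cpath_skeleton:
  assumes "open U"
  shows "\<exists>A\<in>sets borel. U = skeleton -` A"
proof -
  \<comment> \<open>The radius is three times \<open>2\<^bsup>-n\<^esup>\<close>: one oscillation for each path, and the distance on the grid.\<close>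
  define good where "good N n x \<longleftrightarrow> (\<forall>y. (\<forall>t\<in>{0..real N}. dist (eval_path y t) (eval_path x t) \<le> 3 / 2 ^ n) \<longrightarrow> y \<in> U)"
    for N n :: nat and x
  define G where "G N n m = (\<Union>x\<in>{x. good N n x \<and> skeleton x \<in> osc N n m}.
      \<Inter>k\<le>N * 2 ^ m. {z. \<bar>z (k, m) - skeleton x (k, m)\<bar> < 1 / 2 ^ n})" for N n m
  define A where "A = (\<Union>N n m. osc N n m \<inter> G N n m)"
  have "open (G N n m)" for N n m
    unfolding G_def
    by (intro open_UN ballI open_INT finite_atMost open_Collect_less continuous_intros continuous_on_product_coordinates)
  then have "A \<in> sets borel"
    unfolding A_def using closed_osc by (intro sets.countable_UN) (auto intro!: sets.countable_UN sets.Int)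
  moreover have "U = skeleton -` A"
  proof
    show "U \<subseteq> skeleton -` A"
    proof
      fix x assume "x \<in> U"
      then obtain K e where K: "compact K" "K \<subseteq> {0..}" "e > 0"
        and U: "\<And>y. (\<forall>t\<in>K. dist (eval_path y t) (eval_path x t) < e) \<Longrightarrow> y \<in> U"
        using assms unfolding open_cpath_def by metis
      obtain C where C: "\<And>t. t \<in> K \<Longrightarrow> \<bar>t\<bar> \<le> C"
        using compact_imp_bounded[OF K(1)] unfolding bounded_real by blast
      obtain N :: nat where N: "C \<le> N" using real_arch_simple by blast
      obtain n where n: "1 / 2 ^ n < e / 3" using ex_power_half_less[of "e / 3"] K(3) by auto
      have "good N n x"
        unfolding good_def
      proof safe
        fix y assume *: "\<forall>t\<in>{0..real N}. dist (eval_path y t) (eval_path x t) \<le> 3 / 2 ^ n"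
        show "y \<in> U"
        proof (intro U ballI)
          fix t assume "t \<in> K"
          then have "t \<in> {0..real N}" using K(2) C[of t] N by auto
          then have "dist (eval_path y t) (eval_path x t) \<le> 3 / 2 ^ n" using * by blast
          also have "\<dots> < e" using n by simp
          finally show "dist (eval_path y t) (eval_path x t) < e" .
        qed
      qed
      moreover obtain m where "skeleton x \<in> osc N n m" using skeleton_mem_osc by blast
      ultimately have "skeleton x \<in> osc N n m \<inter> G N n m"
        unfolding G_def by auto
      then show "x \<in> skeleton -` A"
        unfolding A_def by blast
    qed
    show "skeleton -` A \<subseteq> U"
    proof
      fix y assume "y \<in> skeleton -` A"
      then obtain N n m x where y: "skeleton y \<in> osc N n m" and x: "skeleton x \<in> osc N n m" "good N n x"
        and close: "\<And>k. k \<le> N * 2 ^ m \<Longrightarrow> \<bar>skeleton y (k, m) - skeleton x (k, m)\<bar> < 1 / 2 ^ n"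
        unfolding A_def G_def by blast
      have "dist (eval_path y t) (eval_path x t) \<le> 3 / 2 ^ n" if t: "t \<in> {0..real N}" for t
      proof -
        have "t * 2 ^ m \<le> real (N * 2 ^ m)" using t by simp
        then have "nat \<lfloor>t * 2 ^ m\<rfloor> \<le> N * 2 ^ m" by linarith
        from close[OF this] have "\<bar>skeleton y (dyadic_below t m) - skeleton x (dyadic_below t m)\<bar> < 1 / 2 ^ n"
          by (simp add: dyadic_below_def)
        moreover have "\<bar>eval_path y t - skeleton y (dyadic_below t m)\<bar> \<le> 1 / 2 ^ n"
          "\<bar>eval_path x t - skeleton x (dyadic_below t m)\<bar> \<le> 1 / 2 ^ n"
          using t osc_eval_path[OF y] osc_eval_path[OF x(1)] by auto
        moreover have "3 / 2 ^ n = 1 / 2 ^ n + 1 / 2 ^ n + (1 / 2 ^ n :: real)" by simp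
        ultimately show ?thesis unfolding dist_real_def by linarith
      qed
      then show "y \<in> U" using x(2) unfolding good_def by blast
    qed
  qed
  ultimately show ?thesis by blast
qed

lemma borel_cpath_skeleton:
  assumes "U \<in> sets borel"
  shows "\<exists>A\<in>sets borel. U = skeleton -` A"
proof -
  have sets: "sets (vimage_algebra UNIV skeleton borel) = {skeleton -` A | A. A \<in> sets borel}"
    by (subst sets_vimage_algebra2) auto
  have "sigma_sets UNIV {S. open S} \<subseteq> sets (vimage_algebra UNIV skeleton borel)"
    using sets.sigma_sets_subset[of "{S. open S}" "vimage_algebra UNIV skeleton borel"] open_cpath_skeleton
    unfolding sets by auto
  then show ?thesis
    using assms unfolding sets by (auto simp: borel_def)
qed

lemma measurable_cpathI:
  assumes "\<And>p. (\<lambda>\<omega>. skeleton (\<xi> \<omega>) p) \<in> borel_measurable N"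
  shows "\<xi> \<in> borel_measurable N"
proof (rule borel_measurableI)
  fix U :: "cpath set" assume "open U"
  then obtain A where A: "A \<in> sets borel" "U = skeleton -` A"
    using open_cpath_skeleton by blast
  have "(\<lambda>\<omega>. skeleton (\<xi> \<omega>)) \<in> borel_measurable N"
    using assms by (rule measurable_coordinatewise_then_product)
  from measurable_sets[OF this A(1)] show "\<xi> -` U \<inter> space N \<in> sets N"
    by (simp add: A(2) vimage_def)
qed

lemma skeleton_measurable [measurable]: "skeleton \<in> borel_measurable borel"
proof (rule measurable_coordinatewise_then_product)
  fix p
  have "continuous_on UNIV (\<lambda>x. skeleton x p)"
    unfolding continuous_on_def
  proof safe
    fix x :: cpath
    have "((\<lambda>y. y) \<longlongrightarrow> x) (at x)" by (rule tendsto_ident_at)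
    then have "uniform_limit {dyadic p} eval_path (eval_path x) (at x)"
      unfolding tendsto_cpath_iff by (elim allE[of _ "{dyadic p}"]) auto
    from tendsto_uniform_limitI[OF this, of "dyadic p"] show "((\<lambda>x. skeleton x p) \<longlongrightarrow> skeleton x p) (at x)"
      by (simp add: skeleton_def)
  qed
  then show "(\<lambda>x. skeleton x p) \<in> borel_measurable borel"
    by (rule borel_measurable_continuous_onI)
qed

section \<open>From finitely many coordinates to path space\<close>

text \<open>A set defined by the finitely many coordinates with both indices at most \<open>m\<close>; all of the corresponding times
  are multiples of \<open>2\<^bsup>-m\<^esup>\<close>, hence lie on one grid.\<close>

definition upper_hull :: "nat \<Rightarrow> (nat \<times> nat \<Rightarrow> real) set \<Rightarrow> (nat \<times> nat \<Rightarrow> real) set" where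
  "upper_hull m K = {z. \<exists>x\<in>K. \<forall>k\<le>m. \<forall>j\<le>m. x (k, j) \<le> z (k, j)}"

lemma tendsto_coordinate:
  fixes f :: "nat \<Rightarrow> 'i \<Rightarrow> real"
  assumes "f \<longlonglongrightarrow> x"
  shows "(\<lambda>i. f i p) \<longlonglongrightarrow> x p"
  using continuous_on_tendsto_compose[OF continuous_on_product_coordinates assms, of p] by simp

lemma closed_upper_hull:
  assumes "compact K"
  shows "closed (upper_hull m K)"
  unfolding closed_sequential_limits
proof safe
  fix z l assume z: "\<forall>i. z i \<in> upper_hull m K" and l: "z \<longlonglongrightarrow> l"
  obtain x where x: "\<And>i. x i \<in> K" "\<And>i k j. k \<le> m \<Longrightarrow> j \<le> m \<Longrightarrow> x i (k, j) \<le> z i (k, j)"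
    using z unfolding upper_hull_def by simp metis
  obtain y r where y: "y \<in> K" "strict_mono (r :: nat \<Rightarrow> nat)" "(x \<circ> r) \<longlonglongrightarrow> y"
    using assms x(1) unfolding compact_def by blast
  have "y (k, j) \<le> l (k, j)" if "k \<le> m" "j \<le> m" for k j
    using tendsto_coordinate[OF y(3)] tendsto_coordinate[OF LIMSEQ_subseq_LIMSEQ[OF l y(2)]]
    by (rule LIMSEQ_le) (use x(2)[OF that] in auto)
  with y(1) show "l \<in> upper_hull m K"
    unfolding upper_hull_def by blast
qed

text \<open>Lower bounds chosen in \<open>K\<close> for ever more coordinates have a cluster point in \<open>K\<close>, which is a bound for
  all coordinates.\<close>

lemma Inter_upper_hull:
  assumes "compact K" "z \<in> (\<Inter>m. upper_hull m K)"
  shows "\<exists>x\<in>K. x \<le> z"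
proof -
  obtain x where x: "\<And>m. x m \<in> K" "\<And>m k j. k \<le> m \<Longrightarrow> j \<le> m \<Longrightarrow> x m (k, j) \<le> z (k, j)"
    using assms(2) unfolding upper_hull_def by simp metis
  obtain y r where y: "y \<in> K" "strict_mono (r :: nat \<Rightarrow> nat)" "(x \<circ> r) \<longlonglongrightarrow> y"
    using assms(1) x(1) unfolding compact_def by blast
  have "y (k, j) \<le> z (k, j)" for k j
  proof (rule LIMSEQ_le_const2[OF tendsto_coordinate[OF y(3)]])
    have "(x \<circ> r) i (k, j) \<le> z (k, j)" if "i \<ge> max k j" for i
      using that seq_suble[OF y(2), of i] by (auto intro!: x(2))
    then show "\<exists>i0. \<forall>i\<ge>i0. (x \<circ> r) i (k, j) \<le> z (k, j)" by blast
  qed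
  with y(1) show ?thesis by (auto simp: le_fun_def)
qed

text \<open>Finite-dimensional comparison implies comparison on all upper Borel sets. The compact sets are taken inside
  the range of \<open>skeleton\<close>: their elements are then paths of \<open>U\<close>, and the order of skeletons is the order of paths.\<close>

lemma emeasure_upper_set_le:
  fixes \<xi> :: "'a \<Rightarrow> cpath" and \<eta> :: "'b \<Rightarrow> cpath"
  assumes "prob_space M" "prob_space N"
    and [measurable]: "\<xi> \<in> borel_measurable M" "\<eta> \<in> borel_measurable N"
    and hull: "\<And>K m. compact K \<Longrightarrow> emeasure M {\<omega>\<in>space M. skeleton (\<xi> \<omega>) \<in> upper_hull m K}
        \<le> emeasure N {\<omega>\<in>space N. skeleton (\<eta> \<omega>) \<in> upper_hull m K}"
    and U: "U \<in> sets borel" "\<And>x y. x \<in> U \<Longrightarrow> x \<le> y \<Longrightarrow> y \<in> U"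
  shows "emeasure M {\<omega>\<in>space M. \<xi> \<omega> \<in> U} \<le> emeasure N {\<omega>\<in>space N. \<eta> \<omega> \<in> U}"
proof -
  interpret N: prob_space N by fact
  obtain A where A: "A \<in> sets borel" "U = skeleton -` A"
    using borel_cpath_skeleton[OF U(1)] by blast
  define P where "P = distr M borel (\<lambda>\<omega>. skeleton (\<xi> \<omega>))"
  define Q where "Q = distr N borel (\<lambda>\<omega>. skeleton (\<eta> \<omega>))"
  have P: "emeasure P S = emeasure M {\<omega>\<in>space M. skeleton (\<xi> \<omega>) \<in> S}" if "S \<in> sets borel" for S
    unfolding P_def using that by (subst emeasure_distr) (auto intro!: arg_cong[of _ _ "emeasure M"])
  have Q: "emeasure Q S = emeasure N {\<omega>\<in>space N. skeleton (\<eta> \<omega>) \<in> S}" if "S \<in> sets borel" for S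
    unfolding Q_def using that by (subst emeasure_distr) (auto intro!: arg_cong[of _ _ "emeasure N"])
  have "prob_space P"
    unfolding P_def by (rule prob_space.prob_space_distr) (use assms in auto)
  then have finite: "emeasure P (space P) \<noteq> \<infinity>"
    by (simp add: prob_space.emeasure_space_1)
  define A' where "A' = A \<inter> range skeleton"
  have A': "A' \<in> sets borel"
    unfolding A'_def using A(1) range_skeleton_borel by auto
  have "emeasure P A' \<le> emeasure N {\<omega>\<in>space N. \<eta> \<omega> \<in> U}"
  proof (subst inner_regular[OF _ finite A'])
    show "sets P = sets borel" by (simp add: P_def)
    show "(SUP K\<in>{K. K \<subseteq> A' \<and> compact K}. emeasure P K) \<le> emeasure N {\<omega>\<in>space N. \<eta> \<omega> \<in> U}"
    proof (rule SUP_least, safe)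
      fix K assume K: "K \<subseteq> A'" "compact K"
      have hull_borel: "upper_hull m K \<in> sets borel" for m
        using closed_upper_hull[OF K(2)] by (rule borel_closed)
      have "emeasure P K \<le> emeasure Q (upper_hull m K)" for m
      proof -
        have "emeasure P K \<le> emeasure P (upper_hull m K)"
          using hull_borel by (intro emeasure_mono) (auto simp: P_def upper_hull_def)
        also have "\<dots> \<le> emeasure Q (upper_hull m K)"
          unfolding P[OF hull_borel] Q[OF hull_borel] by (rule hull[OF K(2)])
        finally show ?thesis .
      qed
      then have "emeasure P K \<le> (INF m. emeasure Q (upper_hull m K))"
        by (intro INF_greatest)
      also have "\<dots> = emeasure Q (\<Inter>m. upper_hull m K)"
      proof (rule INF_emeasure_decseq)
        show "decseq (\<lambda>m. upper_hull m K)"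
          by (auto simp: decseq_def upper_hull_def) (meson order_trans)
        show "emeasure Q (upper_hull m K) \<noteq> \<infinity>" for m
          unfolding Q[OF hull_borel] by simp
      qed (use hull_borel in \<open>auto simp: Q_def\<close>)
      also have "\<dots> = emeasure N {\<omega>\<in>space N. skeleton (\<eta> \<omega>) \<in> (\<Inter>m. upper_hull m K)}"
        using hull_borel by (intro Q sets.countable_INT'') auto
      also have "\<dots> \<le> emeasure N {\<omega>\<in>space N. \<eta> \<omega> \<in> U}"
      proof (rule emeasure_mono)
        show "{\<omega>\<in>space N. skeleton (\<eta> \<omega>) \<in> (\<Inter>m. upper_hull m K)} \<subseteq> {\<omega>\<in>space N. \<eta> \<omega> \<in> U}"
        proof safe
          fix \<omega> assume "skeleton (\<eta> \<omega>) \<in> (\<Inter>m. upper_hull m K)"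
          then obtain x where x: "x \<in> K" "x \<le> skeleton (\<eta> \<omega>)"
            using Inter_upper_hull[OF K(2)] by blast
          then obtain x' where "x = skeleton x'" "x' \<in> U"
            using K(1) unfolding A'_def A(2) by blast
          with x(2) show "\<eta> \<omega> \<in> U"
            using U(2) by (simp add: skeleton_le_iff)
        qed
        show "{\<omega>\<in>space N. \<eta> \<omega> \<in> U} \<in> sets N"
          using U(1) by measurable
      qed
      finally show "emeasure P K \<le> emeasure N {\<omega>\<in>space N. \<eta> \<omega> \<in> U}" .
    qed
  qed
  also have "emeasure P A' = emeasure M {\<omega>\<in>space M. \<xi> \<omega> \<in> U}"
    unfolding P[OF A'] by (auto simp: A'_def A(2) intro!: arg_cong[of _ _ "emeasure M"])
  finally show ?thesis .
qed

lemma nn_integral_layer_cake: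
  assumes "sigma_finite_measure M" and [measurable]: "g \<in> borel_measurable M" and nonneg: "\<And>\<omega>. g \<omega> \<ge> 0"
  shows "(\<integral>\<^sup>+\<omega>. ennreal (g \<omega>) \<partial>M) = (\<integral>\<^sup>+c. indicator {0..} c * emeasure M {\<omega>\<in>space M. c < g \<omega>} \<partial>lborel)"
proof -
  interpret M: sigma_finite_measure M by fact
  interpret pair_sigma_finite M lborel ..
  have "(\<integral>\<^sup>+\<omega>. ennreal (g \<omega>) \<partial>M) = (\<integral>\<^sup>+\<omega>. (\<integral>\<^sup>+c. indicator {(\<omega>, c). 0 \<le> c \<and> c < g \<omega>} (\<omega>, c) \<partial>lborel) \<partial>M)"
  proof (intro nn_integral_cong)
    fix \<omega>
    have "ennreal (g \<omega>) = (\<integral>\<^sup>+c. indicator {0..<g \<omega>} c \<partial>lborel)"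
      using nonneg[of \<omega>] by simp
    also have "\<dots> = (\<integral>\<^sup>+c. indicator {(\<omega>, c). 0 \<le> c \<and> c < g \<omega>} (\<omega>, c) \<partial>lborel)"
      by (intro nn_integral_cong) (simp add: indicator_def)
    finally show "ennreal (g \<omega>) = \<dots>" .
  qed
  also have "\<dots> = (\<integral>\<^sup>+c. (\<integral>\<^sup>+\<omega>. indicator {(\<omega>, c). 0 \<le> c \<and> c < g \<omega>} (\<omega>, c) \<partial>M) \<partial>lborel)"
    by (rule Fubini'[symmetric]) (simp add: indicator_def)
  also have "\<dots> = (\<integral>\<^sup>+c. indicator {0..} c * emeasure M {\<omega>\<in>space M. c < g \<omega>} \<partial>lborel)"
  proof (intro nn_integral_cong)
    fix c :: real
    have "(\<integral>\<^sup>+\<omega>. indicator {(\<omega>, c). 0 \<le> c \<and> c < g \<omega>} (\<omega>, c) \<partial>M) =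
        (\<integral>\<^sup>+\<omega>. indicator {0..} c * indicator {\<omega>\<in>space M. c < g \<omega>} \<omega> \<partial>M)"
      by (intro nn_integral_cong) (simp add: indicator_def)
    also have "\<dots> = indicator {0..} c * emeasure M {\<omega>\<in>space M. c < g \<omega>}"
      by (subst nn_integral_cmult_indicator) auto
    finally show "(\<integral>\<^sup>+\<omega>. indicator {(\<omega>, c). 0 \<le> c \<and> c < g \<omega>} (\<omega>, c) \<partial>M) = \<dots>" .
  qed
  finally show ?thesis .
qed

text \<open>The layer cake formula applies after adding a constant that makes \<open>f\<close> nonnegative.\<close>

lemma stoch_leI:
  assumes "prob_space M" "prob_space N"
    and [measurable]: "\<xi> \<in> borel_measurable M" "\<eta> \<in> borel_measurable N"
    and upper: "\<And>U. U \<in> sets borel \<Longrightarrow> (\<And>x y. x \<in> U \<Longrightarrow> x \<le> y \<Longrightarrow> y \<in> U) \<Longrightarrow>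
      emeasure M {\<omega>\<in>space M. \<xi> \<omega> \<in> U} \<le> emeasure N {\<omega>\<in>space N. \<eta> \<omega> \<in> U}"
  shows "stoch_le M \<xi> N \<eta>"
  unfolding stoch_le_def
proof safe
  fix f :: "cpath \<Rightarrow> real"
  assume f [measurable]: "f \<in> borel_measurable borel" and "bounded (range f)" and "mono f"
  interpret M: prob_space M by fact
  interpret N: prob_space N by fact
  obtain C where C: "\<And>x. \<bar>f x\<bar> \<le> C"
    using \<open>bounded (range f)\<close> unfolding bounded_real by auto
  have int: "integrable M (\<lambda>\<omega>. f (\<xi> \<omega>))" "integrable N (\<lambda>\<omega>. f (\<eta> \<omega>))"
    using C by (auto intro!: M.integrable_const_bound[of _ C] N.integrable_const_bound[of _ C])
  have nonneg: "f x + C \<ge> 0" for x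
    using C[of x] by linarith
  have "(\<integral>\<^sup>+\<omega>. ennreal (f (\<xi> \<omega>) + C) \<partial>M) \<le> (\<integral>\<^sup>+\<omega>. ennreal (f (\<eta> \<omega>) + C) \<partial>N)"
  proof -
    have "emeasure M {\<omega>\<in>space M. c < f (\<xi> \<omega>) + C} \<le> emeasure N {\<omega>\<in>space N. c < f (\<eta> \<omega>) + C}" for c
    proof -
      have "{x. c < f x + C} \<in> sets borel" by measurable
      moreover have "y \<in> {x. c < f x + C}" if "x \<in> {x. c < f x + C}" "x \<le> y" for x y
        using that monoD[OF \<open>mono f\<close>, of x y] by simp
      ultimately show ?thesis using upper[of "{x. c < f x + C}"] by simp
    qed
    then show ?thesis
      using nonneg
      by (simp add: nn_integral_layer_cake[OF M.sigma_finite_measure_axioms] nn_integral_layer_cake[OF N.sigma_finite_measure_axioms])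
         (intro nn_integral_mono mult_left_mono, auto)
  qed
  moreover have "(\<integral>\<^sup>+\<omega>. ennreal (f (\<xi> \<omega>) + C) \<partial>M) = ennreal (\<integral>\<omega>. f (\<xi> \<omega>) + C \<partial>M)"
    using int nonneg by (intro nn_integral_eq_integral) auto
  moreover have "(\<integral>\<^sup>+\<omega>. ennreal (f (\<eta> \<omega>) + C) \<partial>N) = ennreal (\<integral>\<omega>. f (\<eta> \<omega>) + C \<partial>N)"
    using int nonneg by (intro nn_integral_eq_integral) auto
  moreover have "(\<integral>\<omega>. f (\<eta> \<omega>) + C \<partial>N) \<ge> 0"
    using nonneg by (intro integral_nonneg_AE) auto
  ultimately have "(\<integral>\<omega>. f (\<xi> \<omega>) + C \<partial>M) \<le> (\<integral>\<omega>. f (\<eta> \<omega>) + C \<partial>N)"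
    by simp
  then show "(\<integral>\<omega>. f (\<xi> \<omega>) \<partial>M) \<le> (\<integral>\<omega>. f (\<eta> \<omega>) \<partial>N)"
    using int by (simp add: M.prob_space N.prob_space)
qed

context brownian_motion
begin

lemma skeleton_abs_drift_path:
  "\<omega> \<in> space M \<Longrightarrow> skeleton (abs_drift_path B \<mu> \<omega>) p = \<bar>drift_BM B \<mu> (dyadic p) \<omega>\<bar>"
  unfolding skeleton_def by (simp add: eval_abs_drift_path drift_BM_def)

lemma abs_drift_path_measurable [measurable]: "abs_drift_path B \<mu> \<in> borel_measurable M"
proof (rule measurable_cpathI)
  fix p
  have "(\<lambda>\<omega>. \<bar>drift_BM B \<mu> (dyadic p) \<omega>\<bar>) \<in> borel_measurable M"
    by measurable
  then show "(\<lambda>\<omega>. skeleton (abs_drift_path B \<mu> \<omega>) p) \<in> borel_measurable M"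
    by (subst measurable_cong[OF skeleton_abs_drift_path])
qed

lemma upper_hull_mono_drift:
  assumes "compact K" "\<bar>a\<bar> \<le> \<bar>b\<bar>"
  shows "emeasure M {\<omega>\<in>space M. skeleton (abs_drift_path B a \<omega>) \<in> upper_hull m K}
    \<le> emeasure M {\<omega>\<in>space M. skeleton (abs_drift_path B b \<omega>) \<in> upper_hull m K}"
proof -
  \<comment> \<open>\<open>refine\<close> reads the dyadic value with code \<open>(k, j)\<close>, \<open>j \<le> m\<close>, off the grid of mesh \<open>2\<^bsup>-m\<^esup>\<close>. Up to time \<open>m\<close> the
    grid has \<open>m 2\<^bsup>m\<^esup>\<close> steps.\<close>
  define refine where "refine = (\<lambda>(v :: nat \<Rightarrow> real) (k, j). v (k * 2 ^ (m - j)))"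
  define F where "F = (\<lambda>v. indicator (upper_hull m K) (refine v) :: ennreal)"
  have [measurable]: "upper_hull m K \<in> sets borel"
    using closed_upper_hull[OF assms(1)] by (rule borel_closed)
  have [measurable]: "refine \<in> borel_measurable borel"
    unfolding refine_def by (rule measurable_coordinatewise_then_product) (auto simp: case_prod_beta)
  have F: "F \<in> borel_measurable borel"
    unfolding F_def by measurable
  have "mono F"
  proof (rule monoI)
    fix u v :: "nat \<Rightarrow> real" assume "u \<le> v"
    then have "refine u p \<le> refine v p" for p
      by (simp add: refine_def le_fun_def case_prod_beta)
    then have "refine v \<in> upper_hull m K" if "refine u \<in> upper_hull m K"
      using that unfolding upper_hull_def by simp (meson order_trans)
    then show "F u \<le> F v"
      by (simp add: F_def indicator_def)
  qed
  have eq: "F (pointwise_abs (grid_path B \<mu> (1 / 2 ^ m) (m * 2 ^ m) \<omega>)) =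
      indicator {\<omega>\<in>space M. skeleton (abs_drift_path B \<mu> \<omega>) \<in> upper_hull m K} \<omega>"
    if "\<omega> \<in> space M" for \<omega> \<mu>
  proof -
    let ?v = "pointwise_abs (grid_path B \<mu> (1 / 2 ^ m) (m * 2 ^ m) \<omega>)"
    have "refine ?v (k, j) = skeleton (abs_drift_path B \<mu> \<omega>) (k, j)" if "k \<le> m" "j \<le> m" for k j
    proof -
      have "k * 2 ^ (m - j) \<le> m * 2 ^ m"
        using that by (intro mult_mono power_increasing) auto
      moreover have "real (k * 2 ^ (m - j)) * (1 / 2 ^ m) = dyadic (k, j)"
        using that by (simp add: dyadic_def field_simps flip: power_add)
      ultimately show ?thesis
        unfolding refine_def pointwise_abs_def grid_path_def
        by (simp add: skeleton_abs_drift_path \<open>\<omega> \<in> space M\<close>)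
    qed
    then have "refine ?v \<in> upper_hull m K \<longleftrightarrow> skeleton (abs_drift_path B \<mu> \<omega>) \<in> upper_hull m K"
      unfolding upper_hull_def by auto
    with that show ?thesis
      by (simp add: F_def indicator_def)
  qed
  have "emeasure M {\<omega>\<in>space M. skeleton (abs_drift_path B \<mu> \<omega>) \<in> upper_hull m K} =
      (\<integral>\<^sup>+\<omega>. F (pointwise_abs (grid_path B \<mu> (1 / 2 ^ m) (m * 2 ^ m) \<omega>)) \<partial>M)" for \<mu>
    by (subst nn_integral_cong[OF eq]) (auto intro!: nn_integral_indicator[symmetric])
  then show ?thesis
    using abs_grid_path_mono_drift[OF _ assms(2) F \<open>mono F\<close>] by (simp add: F_def indicator_def)
qed

lemma stoch_le_abs_drift_path:
  assumes "\<bar>a\<bar> \<le> \<bar>b\<bar>"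
  shows "stoch_le M (abs_drift_path B a) M (abs_drift_path B b)"
proof (rule stoch_leI)
  fix U :: "cpath set"
  assume U: "U \<in> sets borel" "\<And>x y. x \<in> U \<Longrightarrow> x \<le> y \<Longrightarrow> y \<in> U"
  show "emeasure M {\<omega>\<in>space M. abs_drift_path B a \<omega> \<in> U} \<le> emeasure M {\<omega>\<in>space M. abs_drift_path B b \<omega> \<in> U}"
    using U by (intro emeasure_upper_set_le prob_space_axioms upper_hull_mono_drift assms) auto
qed (auto intro: prob_space_axioms)

end

theorem mainTheorem7:
  fixes M :: "'a measure" and B :: "real \<Rightarrow> 'a \<Rightarrow> real"
  assumes "brownian_motion M B"
  shows "(\<forall>\<mu>. abs_drift_path B \<mu> \<in> borel_measurable M) \<and>
    (\<forall>\<mu>' \<mu>''. 0 \<le> \<mu>' \<and> \<mu>' < \<mu>'' \<longrightarrow>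
       stoch_le M (abs_drift_path B \<mu>') M (abs_drift_path B \<mu>'')) \<and>
    (\<forall>\<mu>' \<mu>''. \<mu>' < \<mu>'' \<and> \<mu>'' \<le> 0 \<longrightarrow>
       stoch_le M (abs_drift_path B \<mu>'') M (abs_drift_path B \<mu>'))"
proof -
  interpret brownian_motion M B by fact
  show ?thesis
    by (auto intro!: stoch_le_abs_drift_path)
qed

end
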